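(* Assume the standing setup (A1)–(A2) and let $\eta>0$ with $b<\eta<a$ satisfy the gap condition $\rho:=K\left(\frac{1}{\eta-b}+\frac{1}{a-\eta}\right)<1$. Then for every $\omega\in\Omega$ and every $(\hat x_0,\hat y_0)\in\mathbb{R}^n\times\mathbb{R}^m$, $$\mathcal{W}_\eta((\hat x_0,\hat y_0),\omega)=\{(\xi,\,l(\xi,(\hat x_0,\hat y_0),\omega)) : \xi\in\mathbb{R}^n\},$$ where $$l(\xi,(\hat x_0,\hat y_0),\omega)=\hat y_0+\int_{-\infty}^0 e^{-Bs+\int_s^0 z(\theta_\tau\omega)d\tau}\,\Delta G(u(s),v(s),\theta_s\omega)\,ds,$$ with $(u,v)=\phi(\cdot,\omega,(\hat x_0,\hat y_0);\xi-\hat x_0)$ the unique solution in $C^-_\eta$ of the integral system $$u(t)=e^{At+\int_0^t z(\theta_\tau\omega)d\tau}(\xi-\hat x_0)+\int_0^t e^{A(t-s)+\int_s^t z(\theta_\tau\omega)d\tau}\Delta F(u(s),v(s),\theta_s\omega)\,ds,\quad v(t)=\int_{-\infty}^t e^{B(t-s)+\int_s^t z(\theta_\tau\omega)d\tau}\Delta G(u(s),v(s),\theta_s\omega)\,ds,\ t\le0.$$ Moreover $\xi\mapsto l(\xi,(\hat x_0,\hat y_0),\omega)$ is Lipschitz with $$\mathrm{Lip}\,l\le\frac{K}{(\eta-b)\left(1-K\left(\frac{1}{\eta-b}+\frac{1}{a-\eta}\right)\right)}.$$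
   Context: Standing setup: $1<\alpha<2$; $\Omega$ is a $\{\theta_t\}$-invariant full-measure set of càdlàg paths $\omega:\mathbb{R}\to\mathbb{R}$ ($\omega(0)=0$) of a two-sided scalar symmetric $\alpha$-stable Lévy motion, with $\theta_t\omega=\omega(\cdot+t)-\omega(t)$, on which $z(\omega)=-\int_{-\infty}^0e^\tau\omega(\tau)d\tau$ exists, $t\mapsto z(\theta_t\omega)$ is càdlàg, $\lim_{t\to\pm\infty}|z(\theta_t\omega)|/|t|=0$ and $\lim_{t\to\pm\infty}\frac1t\int_0^tz(\theta_\tau\omega)d\tau=0$. (A1) $A$ is a real $n\times n$ matrix and $B$ a real $m\times m$ matrix with $|e^{At}x|\le e^{at}|x|$ for $t\le0$ and $|e^{Bt}y|\le e^{bt}|y|$ for $t\ge 0$, where $b<0<a$. (A2) $f:\mathbb{R}^n\times\mathbb{R}^m\to\mathbb{R}^n$, $g:\mathbb{R}^n\times\mathbb{R}^m\to\mathbb{R}^m$ satisfy $f(0,0)=0$, $g(0,0)=0$, $|f(x_1,y_1)-f(x_2,y_2)|\le K(|x_1-x_2|+|y_1-y_2|)$ and the same for $g$. Put $F(x,y,\omega)=e^{-z(\omega)}f(e^{z(\omega)}x,e^{z(\omega)}y)$, $G(x,y,\omega)=e^{-z(\omega)}g(e^{z(\omega)}x,e^{z(\omega)}y)$. The random system (RDE) is $\frac{d\hat x}{dt}=A\hat x+F(\hat x,\hat y,\theta_t\omega)+z(\theta_t\omega)\hat x$, $\frac{d\hat y}{dt}=B\hat y+G(\hat x,\hat y,\theta_t\omega)+z(\theta_t\omega)\hat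 y$; $\varphi(t,\omega,(\hat x_0,\hat y_0))=(\hat x(t),\hat y(t))$ denotes its (Carathéodory) solution, defined for all $t\in\mathbb{R}$, with $(\hat x(0),\hat y(0))=(\hat x_0,\hat y_0)$. $|\cdot|$ is the Euclidean norm. For fixed $\omega$ and $\eta\in\mathbb{R}$, $C^-_\eta$ is the Banach space of continuous $\phi=(u,v):(-\infty,0]\to\mathbb{R}^n\times\mathbb{R}^m$ with $\|\phi\|_{C^-_\eta}=\sup_{t\le0}e^{-\eta t-\int_0^tz(\theta_\tau\omega)d\tau}|u(t)|+\sup_{t\le0}e^{-\eta t-\int_0^tz(\theta_\tau\omega)d\tau}|v(t)|<\infty$. Given a base point $(\hat x_0,\hat y_0)$ with orbit $(\hat x(t),\hat y(t))=\varphi(t,\omega,(\hat x_0,\hat y_0))$, define $\Delta F(u,v,\theta_t\omega)=F(u+\hat x(t),v+\hat y(t),\theta_t\omega)-F(\hat x(t),\hat y(t),\theta_t\omega)$ and $\Delta G$ analogously with $G$. The set $\mathcal{W}_\eta((\hat x_0,\hat y_0),\omega)$ (the unstable fiber through $(\hat x_0,\hat y_0)$) is the set of all $(\hat x_0^*,\hat y_0^* )\in\mathbb{R}^n\times\mathbb{R}^m$ such that the function $t\mapsto\varphi(t,\omega,(\hat x_0^*,\hat y_0^* ))-\varphi(t,\omega,(\hat x_0,\hat y_0))$, $t\le0$, belongs to $C^-_\eta$. *)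

theory Defs
  imports "HOL-Analysis.Analysis"
begin

primrec matpow :: "real^'n^'n \<Rightarrow> nat \<Rightarrow> real^'n^'n" where
  "matpow M 0 = mat 1"
| "matpow M (Suc k) = M ** matpow M k"

definition mat_exp :: "real^'n^'n \<Rightarrow> real^'n^'n" where
  "mat_exp M = (\<Sum>k. (1 / fact k) *\<^sub>R matpow M k)"

definition theta :: "real \<Rightarrow> (real \<Rightarrow> real) \<Rightarrow> (real \<Rightarrow> real)" where
  "theta t \<omega> = (\<lambda>s. \<omega> (s + t) - \<omega> t)"

definition zf :: "(real \<Rightarrow> real) \<Rightarrow> real" where
  "zf \<omega> = - (LINT \<tau>:{..0}|lborel. exp \<tau> * \<omega> \<tau>)"

definition zeta :: "(real \<Rightarrow> real) \<Rightarrow> real \<Rightarrow> real" where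
  "zeta \<omega> t = zf (theta t \<omega>)"

definition cadlag :: "(real \<Rightarrow> real) \<Rightarrow> bool" where
  "cadlag h \<longleftrightarrow> (\<forall>t. continuous (at_right t) h \<and> (\<exists>l. (h \<longlongrightarrow> l) (at_left t)))"

definition Iz :: "(real \<Rightarrow> real) \<Rightarrow> real \<Rightarrow> real \<Rightarrow> real" where
  "Iz \<omega> a b = interval_lebesgue_integral lborel (ereal a) (ereal b) (zeta \<omega>)"

text \<open>Standing properties of the set Omega of paths (deterministic part of the setup).\<close>
definition Omega_props :: "(real \<Rightarrow> real) set \<Rightarrow> bool" where
  "Omega_props \<Omega> \<longleftrightarrow> (\<forall>\<omega>\<in>\<Omega>.
      \<omega> 0 = 0 \<and> cadlag \<omega> \<and> (\<forall>t. theta t \<omega> \<in> \<Omega>) \<and>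
      set_integrable lborel {..0} (\<lambda>\<tau>. exp \<tau> * \<omega> \<tau>) \<and>
      cadlag (zeta \<omega>) \<and>
      (\<forall>t. interval_lebesgue_integrable lborel (ereal 0) (ereal t) (zeta \<omega>)) \<and>
      ((\<lambda>t. \<bar>zeta \<omega> t\<bar> / \<bar>t\<bar>) \<longlongrightarrow> 0) at_top \<and>
      ((\<lambda>t. \<bar>zeta \<omega> t\<bar> / \<bar>t\<bar>) \<longlongrightarrow> 0) at_bot \<and>
      ((\<lambda>t. Iz \<omega> 0 t / t) \<longlongrightarrow> 0) at_top \<and>
      ((\<lambda>t. Iz \<omega> 0 t / t) \<longlongrightarrow> 0) at_bot)"

definition Ftr :: "(real \<Rightarrow> real) \<Rightarrow> (real^'n \<Rightarrow> real^'m \<Rightarrow> 'c::real_vector)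
                   \<Rightarrow> real^'n \<Rightarrow> real^'m \<Rightarrow> real \<Rightarrow> 'c" where
  "Ftr \<omega> f x y t = exp (- zeta \<omega> t) *\<^sub>R f (exp (zeta \<omega> t) *\<^sub>R x) (exp (zeta \<omega> t) *\<^sub>R y)"

definition rde_rhs :: "(real \<Rightarrow> real) \<Rightarrow> real^'n^'n \<Rightarrow> real^'m^'m
      \<Rightarrow> (real^'n \<Rightarrow> real^'m \<Rightarrow> real^'n) \<Rightarrow> (real^'n \<Rightarrow> real^'m \<Rightarrow> real^'m)
      \<Rightarrow> real \<Rightarrow> (real^'n) \<times> (real^'m) \<Rightarrow> (real^'n) \<times> (real^'m)" where
  "rde_rhs \<omega> A B f g t p =
     (A *v fst p + Ftr \<omega> f (fst p) (snd p) t + zeta \<omega> t *\<^sub>R fst p,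
      B *v snd p + Ftr \<omega> g (fst p) (snd p) t + zeta \<omega> t *\<^sub>R snd p)"

text \<open>Caratheodory solution on all of R, in integral-equation form.\<close>
definition is_rde_sol :: "(real \<Rightarrow> real) \<Rightarrow> real^'n^'n \<Rightarrow> real^'m^'m
      \<Rightarrow> (real^'n \<Rightarrow> real^'m \<Rightarrow> real^'n) \<Rightarrow> (real^'n \<Rightarrow> real^'m \<Rightarrow> real^'m)
      \<Rightarrow> (real^'n) \<times> (real^'m) \<Rightarrow> (real \<Rightarrow> (real^'n) \<times> (real^'m)) \<Rightarrow> bool" where
  "is_rde_sol \<omega> A B f g p0 s \<longleftrightarrow>
     continuous_on UNIV s \<and>
     (\<forall>t. interval_lebesgue_integrable lborel (ereal 0) (ereal t) (\<lambda>r. rde_rhs \<omega> A B f g r (s r)) \<and>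
          s t = p0 + interval_lebesgue_integral lborel (ereal 0) (ereal t) (\<lambda>r. rde_rhs \<omega> A B f g r (s r)))"

definition phi :: "(real \<Rightarrow> real) \<Rightarrow> real^'n^'n \<Rightarrow> real^'m^'m
      \<Rightarrow> (real^'n \<Rightarrow> real^'m \<Rightarrow> real^'n) \<Rightarrow> (real^'n \<Rightarrow> real^'m \<Rightarrow> real^'m)
      \<Rightarrow> real \<Rightarrow> (real^'n) \<times> (real^'m) \<Rightarrow> (real^'n) \<times> (real^'m)" where
  "phi \<omega> A B f g t p0 = (THE s. is_rde_sol \<omega> A B f g p0 s) t"

definition Cminus :: "(real \<Rightarrow> real) \<Rightarrow> real \<Rightarrow> (real \<Rightarrow> (real^'n) \<times> (real^'m)) \<Rightarrow> bool" where
  "Cminus \<omega> \<eta> \<phi> \<longleftrightarrow> continuous_on {..0} \<phi> \<and>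
     bdd_above ((\<lambda>t. exp (- \<eta> * t - Iz \<omega> 0 t) * norm (fst (\<phi> t))) ` {..0}) \<and>
     bdd_above ((\<lambda>t. exp (- \<eta> * t - Iz \<omega> 0 t) * norm (snd (\<phi> t))) ` {..0})"

definition Wfiber :: "(real \<Rightarrow> real) \<Rightarrow> real^'n^'n \<Rightarrow> real^'m^'m
      \<Rightarrow> (real^'n \<Rightarrow> real^'m \<Rightarrow> real^'n) \<Rightarrow> (real^'n \<Rightarrow> real^'m \<Rightarrow> real^'m)
      \<Rightarrow> real \<Rightarrow> (real^'n) \<times> (real^'m) \<Rightarrow> ((real^'n) \<times> (real^'m)) set" where
  "Wfiber \<omega> A B f g \<eta> p0 =
     {p. Cminus \<omega> \<eta> (\<lambda>t. phi \<omega> A B f g t p - phi \<omega> A B f g t p0)}"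

definition Delta :: "(real \<Rightarrow> real) \<Rightarrow> real^'n^'n \<Rightarrow> real^'m^'m
      \<Rightarrow> (real^'n \<Rightarrow> real^'m \<Rightarrow> real^'n) \<Rightarrow> (real^'n \<Rightarrow> real^'m \<Rightarrow> real^'m)
      \<Rightarrow> (real^'n \<Rightarrow> real^'m \<Rightarrow> 'c::real_vector)
      \<Rightarrow> (real^'n) \<times> (real^'m) \<Rightarrow> real \<Rightarrow> (real^'n) \<times> (real^'m) \<Rightarrow> 'c" where
  "Delta \<omega> A B f g h p0 t q =
     Ftr \<omega> h (fst q + fst (phi \<omega> A B f g t p0)) (snd q + snd (phi \<omega> A B f g t p0)) t
     - Ftr \<omega> h (fst (phi \<omega> A B f g t p0)) (snd (phi \<omega> A B f g t p0)) t"

definition LP_sol :: "(real \<Rightarrow> real) \<Rightarrow> real^'n^'n \<Rightarrow> real^'m^'m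
      \<Rightarrow> (real^'n \<Rightarrow> real^'m \<Rightarrow> real^'n) \<Rightarrow> (real^'n \<Rightarrow> real^'m \<Rightarrow> real^'m)
      \<Rightarrow> real \<Rightarrow> (real^'n) \<times> (real^'m) \<Rightarrow> real^'n \<Rightarrow> (real \<Rightarrow> (real^'n) \<times> (real^'m)) \<Rightarrow> bool" where
  "LP_sol \<omega> A B f g \<eta> p0 x \<phi> \<longleftrightarrow> Cminus \<omega> \<eta> \<phi> \<and>
     (\<forall>t\<le>0.
        interval_lebesgue_integrable lborel (ereal 0) (ereal t)
          (\<lambda>s. exp (Iz \<omega> s t) *\<^sub>R (mat_exp ((t - s) *\<^sub>R A) *v Delta \<omega> A B f g f p0 s (\<phi> s))) \<and>
        fst (\<phi> t) = exp (Iz \<omega> 0 t) *\<^sub>R (mat_exp (t *\<^sub>R A) *v x)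
          + interval_lebesgue_integral lborel (ereal 0) (ereal t)
              (\<lambda>s. exp (Iz \<omega> s t) *\<^sub>R (mat_exp ((t - s) *\<^sub>R A) *v Delta \<omega> A B f g f p0 s (\<phi> s))) \<and>
        set_integrable lborel {..t}
          (\<lambda>s. exp (Iz \<omega> s t) *\<^sub>R (mat_exp ((t - s) *\<^sub>R B) *v Delta \<omega> A B f g g p0 s (\<phi> s))) \<and>
        snd (\<phi> t) = (LINT s:{..t}|lborel.
            exp (Iz \<omega> s t) *\<^sub>R (mat_exp ((t - s) *\<^sub>R B) *v Delta \<omega> A B f g g p0 s (\<phi> s))))"

text \<open>l(xi, p0, omega); the LP solution is chosen by SOME (it is unique on t <= 0 by the theorem).\<close>
definition lmap :: "(real \<Rightarrow> real) \<Rightarrow> real^'n^'n \<Rightarrow> real^'m^'m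
      \<Rightarrow> (real^'n \<Rightarrow> real^'m \<Rightarrow> real^'n) \<Rightarrow> (real^'n \<Rightarrow> real^'m \<Rightarrow> real^'m)
      \<Rightarrow> real \<Rightarrow> (real^'n) \<times> (real^'m) \<Rightarrow> real^'n \<Rightarrow> real^'m" where
  "lmap \<omega> A B f g \<eta> p0 \<xi> =
     (let \<phi> = (SOME \<phi>. LP_sol \<omega> A B f g \<eta> p0 (\<xi> - fst p0) \<phi>)
      in snd p0 + (LINT s:{..0}|lborel.
           exp (Iz \<omega> s 0) *\<^sub>R (mat_exp ((- s) *\<^sub>R B) *v Delta \<omega> A B f g g p0 s (\<phi> s))))"

end

theory Submission
  imports Defs
begin

text \<open>
  With \<open>Z t = \<integral>\<^sub>0\<^sup>t z(\<theta>\<^sub>\<tau>\<omega>) d\<tau>\<close>, the substitution \<open>S = e\<^sup>-\<^sup>Z s\<close> removes the term \<open>z s\<close> from the random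
  equation and leaves a nonautonomous system whose nonlinearity is still Lipschitz with constant
  \<open>K\<close>, uniformly in time. A cadlag path is continuous off a countable set, and a continuous function
  with derivative \<open>0\<close> off a countable set is constant; so the Caratheodory integral equations are equivalent to
  differential equations off that set, and the product rule and variation of constants
  are the classical ones. In the transformed coordinates a difference of two orbits that grows at
  most like \<open>e\<^sup>\<eta>\<^sup>t\<close> at \<open>-\<infinity>\<close> is the same as a fixed point of the Lyapunov-Perron operator,
  which contracts with rate \<open>K (1 / (\<eta> - b) + 1 / (a - \<eta>))\<close> in the weighted norm
  \<open>sup e\<^sup>-\<^sup>\<eta>\<^sup>t (|u| + |v|)\<close>.
\<close>

text \<open>The fiber is a graph because the growth condition leaves no freedom in the stable
  component: two candidates for its initial value differ by a vector of size at most a constant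
  times e^((\<eta> - b) t) for every t \<le> 0, hence by zero. The unstable initial value stays
  free, since the solution of the A-part decays at minus infinity like e^(a t) and a > \<eta>. The
  integrals of e^(b (t - s)) e^(\<eta> s) over s \<le> t and of e^(a (t - s)) e^(\<eta> s) over t
  \<le> s \<le> 0 produce the two fractions of the gap condition. The integral term in l is the
  stable component at time 0, so Lip l carries only 1 / (\<eta> - b), multiplied by the factor 1 /
  (1 - \<rho>) with which fixed points depend on \<xi>. An obstacle shapes the statements:
  Lyapunov-Perron paths live on a half line and orbits on the whole line. Paths are therefore
  extended by their value at 0, and equations are compared for t \<le> 0 only.\<close>

section \<open>Integral and differential equations off a countable set\<close>

text \<open>If the claim failed, a level strictly between the two end values and outside the countable set
  \<open>f ` D\<close> would be attained for the last time at a point with positive derivative.\<close>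
lemma increasing_if_deriv_pos_off_countable:
  fixes f :: "real \<Rightarrow> real"
  assumes "countable D" "a \<le> b" and cont: "continuous_on {a..b} f"
    and deriv: "\<And>t. t \<in> {a..<b} - D \<Longrightarrow> \<exists>d>0. (f has_real_derivative d) (at t)"
  shows "f a \<le> f b"
proof (rule ccontr)
  assume "\<not> f a \<le> f b"
  hence "uncountable {f b<..<f a}" by (simp add: uncountable_open_interval)
  moreover have "countable (f ` D)" using assms(1) by simp
  ultimately obtain y where y: "f b < y" "y < f a" "y \<notin> f ` D"
    using countable_subset[of "{f b<..<f a}" "f ` D"] by (auto simp: subset_iff)
  define S where "S = {t\<in>{a..b}. y \<le> f t}"
  have "closed S"
    using continuous_closed_preimage[OF cont closed_atLeastAtMost closed_atLeast, of y]
    by (simp add: S_def vimage_def Int_def)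
  moreover have bdd: "bdd_above S" by (rule bdd_aboveI[of _ b]) (auto simp: S_def)
  moreover have "a \<in> S" using assms(2) y by (auto simp: S_def)
  ultimately have "Sup S \<in> S" using closed_contains_Sup[of S] by auto
  define c where "c = Sup S"
  have cS: "c \<in> {a..b}" "y \<le> f c" using \<open>Sup S \<in> S\<close> by (auto simp: S_def c_def)
  have "c \<noteq> b" using cS y by auto
  hence "c < b" using cS by auto
  have after: "f t < y" if "c < t" "t \<le> b" for t
  proof (rule ccontr)
    assume "\<not> f t < y"
    hence "t \<in> S" using that cS by (auto simp: S_def)
    thus False using cSup_upper[OF _ bdd] that by (force simp: c_def)
  qed
  have "f c \<le> y"
  proof -
    have "(f \<longlongrightarrow> f c) (at c within {c<..b})"
      by (rule tendsto_within_subset[where S="{a..b}"]) (use cont cS in \<open>auto simp: continuous_on_def\<close>)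
    moreover have "eventually (\<lambda>t. f t \<le> y) (at c within {c<..b})"
      unfolding eventually_at_topological
      by (rule exI[of _ UNIV]) (use after in \<open>auto intro: less_imp_le\<close>)
    moreover have "at c within {c<..b} \<noteq> bot"
      using \<open>c < b\<close> by (simp add: at_within_eq_bot_iff closure_greaterThanAtMost)
    ultimately show ?thesis
      by (rule tendsto_upperbound)
  qed
  hence "f c = y" using cS by simp
  hence "c \<notin> D" using y(3) by auto
  with \<open>c < b\<close> cS obtain d where "d > 0" "(f has_real_derivative d) (at c)"
    using deriv[of c] by auto
  from has_real_derivative_pos_inc_right[OF this(2,1)] obtain e
    where e: "e > 0" "\<And>h. h > 0 \<Longrightarrow> h < e \<Longrightarrow> f c < f (c + h)" by auto
  define h where "h = min (e / 2) (b - c)"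
  have "f c < f (c + h)" using e \<open>c < b\<close> by (auto simp: h_def intro!: e(2))
  moreover have "f (c + h) < y" using e \<open>c < b\<close> by (intro after) (auto simp: h_def)
  ultimately show False using \<open>f c = y\<close> by simp
qed

text \<open>Tilting \<open>f\<close> by a small slope \<open>k\<close> turns the zero derivative
  into a positive one, so the preceding lemma applies; the tilt costs \<open>k * (b - a)\<close>,
  which can be made arbitrarily small.\<close>

lemma le_if_deriv_zero_off_countable:
  fixes f :: "real \<Rightarrow> real"
  assumes "countable D" "a \<le> b" "continuous_on {a..b} f"
    and "\<And>t. t \<notin> D \<Longrightarrow> (f has_real_derivative 0) (at t)"
  shows "f a \<le> f b"
proof (rule field_le_epsilon)
  fix e :: real assume "e > 0"
  \<comment> \<open>The summand 1 keeps the denominator positive when \<open>a = b\<close>.\<close>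
  define k where "k = e / (b - a + 1)"
  have "k > 0" using \<open>e > 0\<close> assms(2) by (simp add: k_def)
  have "((\<lambda>t. f t + k * t) has_real_derivative k) (at t)" if "t \<notin> D" for t
    using assms(4)[OF that] by (auto intro!: derivative_eq_intros)
  hence "f a + k * a \<le> f b + k * b"
    using assms(1-3) \<open>k > 0\<close>
    by (intro increasing_if_deriv_pos_off_countable[of D a b "\<lambda>t. f t + k * t"]) (auto intro!: continuous_on_add continuous_on_mult_left)
  hence "f a \<le> f b + k * (b - a)" by (simp add: algebra_simps)
  also have "k * (b - a) \<le> e"
    using \<open>e > 0\<close> assms(2) unfolding k_def by (simp add: field_simps)
  finally show "f a \<le> f b + e" by simp
qed

text \<open>Applied to each coordinate of \<open>f\<close> and to its negative, the real inequality
  becomes an equality.\<close>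

lemma constant_if_deriv_zero_off_countable:
  fixes f :: "real \<Rightarrow> 'a::euclidean_space"
  assumes "countable D" "continuous_on UNIV f"
    and deriv: "\<And>t. t \<notin> D \<Longrightarrow> (f has_vector_derivative 0) (at t)"
  shows "f s = f t"
proof -
  have *: "f s = f t" if "s \<le> t" for s t
  proof (rule euclidean_eqI)
    fix i :: 'a assume "i \<in> Basis"
    have der: "((\<lambda>t. f t \<bullet> i) has_real_derivative 0) (at t)" if "t \<notin> D" for t
      using bounded_linear.has_vector_derivative[OF bounded_linear_inner_left deriv[OF that], of i]
      by (simp add: has_real_derivative_iff_has_vector_derivative)
    have cont: "continuous_on {s..t} (\<lambda>t. f t \<bullet> i)"
      by (intro continuous_intros continuous_on_subset[OF assms(2)]) auto
    have "f s \<bullet> i \<le> f t \<bullet> i"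
      by (rule le_if_deriv_zero_off_countable[OF assms(1) that cont der])
    moreover have "- (f s \<bullet> i) \<le> - (f t \<bullet> i)"
      using DERIV_minus[OF der]
      by (intro le_if_deriv_zero_off_countable[OF assms(1) that continuous_on_minus[OF cont]]) simp
    ultimately show "f s \<bullet> i = f t \<bullet> i" by simp
  qed
  show ?thesis using * by (metis linear)
qed

section \<open>Discontinuities of cadlag paths\<close>

definition discont :: "(real \<Rightarrow> real) \<Rightarrow> real set" where
  "discont h = {t. \<not> isCont h t}"

lemma isCont_if_small_oscillation:
  fixes h :: "real \<Rightarrow> real"
  assumes "\<And>n::nat. \<exists>d>0. \<forall>u v. \<bar>u - t\<bar> < d \<longrightarrow> \<bar>v - t\<bar> < d \<longrightarrow> \<bar>h u - h v\<bar> < 1 / Suc n"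
  shows "isCont h t"
  unfolding continuous_at_eps_delta
proof (intro allI impI)
  fix e :: real assume "e > 0"
  then obtain n where n: "1 / real (Suc n) < e"
    using nat_approx_posE by blast
  from assms[of n] obtain d where "d > 0" and
    d: "\<And>u v. \<bar>u - t\<bar> < d \<Longrightarrow> \<bar>v - t\<bar> < d \<Longrightarrow> \<bar>h u - h v\<bar> < 1 / Suc n" by blast
  have "dist (h u) (h t) < e" if "dist u t < d" for u
    using d[of u t] that \<open>d > 0\<close> n by (simp add: dist_real_def)
  thus "\<exists>d>0. \<forall>u. dist u t < d \<longrightarrow> dist (h u) (h t) < e" using \<open>d > 0\<close> by blast
qed

text \<open>The discontinuities are covered by the sets \<open>osc n\<close> of points around which
  every neighborhood contains two values at least 1/(n+1) apart. One-sided limits at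
  \<open>t\<close> make the oscillation small around every other point near \<open>t\<close>, so
  \<open>osc n\<close> has no limit point, and a set of reals without limit points is
  countable.\<close>

lemma cadlag_countable_discont:
  assumes "cadlag h"
  shows "countable (discont h)"
proof -
  define osc where "osc n = {t. \<not> (\<exists>d>0. \<forall>u v. \<bar>u - t\<bar> < d \<longrightarrow> \<bar>v - t\<bar> < d \<longrightarrow> \<bar>h u - h v\<bar> < 1 / Suc n)}"
    for n :: nat
  \<comment> \<open>Two values within 1/(2(n+1)) of a common \<open>l\<close> are less than 1/(n+1)
    apart; \<open>l\<close> will be the one-sided limit at an endpoint of the open interval.\<close>
  have near: "u \<notin> osc n" if "u \<in> {b<..<c}" "\<And>v. v \<in> {b<..<c} \<Longrightarrow> dist (h v) l < 1 / (2 * Suc n)"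
    for u b c l n
  proof -
    have "\<bar>h v - h w\<bar> < 1 / Suc n"
      if "\<bar>v - u\<bar> < min (u - b) (c - u)" "\<bar>w - u\<bar> < min (u - b) (c - u)" for v w
    proof -
      have "v \<in> {b<..<c}" "w \<in> {b<..<c}" using that by auto
      hence "dist (h v) l < 1 / (2 * Suc n)" "dist (h w) l < 1 / (2 * Suc n)"
        using \<open>\<And>v. v \<in> {b<..<c} \<Longrightarrow> dist (h v) l < 1 / (2 * Suc n)\<close> by blast+
      hence "\<bar>h v - h w\<bar> < 1 / (2 * Suc n) + 1 / (2 * Suc n)"
        unfolding dist_real_def by linarith
      thus ?thesis by (simp add: field_simps)
    qed
    moreover have "min (u - b) (c - u) > 0" using that(1) by auto
    ultimately show ?thesis unfolding osc_def by blast
  qed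
  have "\<not> t islimpt osc n" for t n
  proof -
    from assms obtain l where "(h \<longlongrightarrow> h t) (at_right t)" "(h \<longlongrightarrow> l) (at_left t)"
      by (auto simp: cadlag_def continuous_within)
    hence "eventually (\<lambda>u. dist (h u) (h t) < 1 / (2 * Suc n)) (at_right t)"
      "eventually (\<lambda>u. dist (h u) l < 1 / (2 * Suc n)) (at_left t)"
      by (auto elim!: tendstoD)
    then obtain b c where b: "b > t" "\<And>u. u \<in> {t<..<b} \<Longrightarrow> dist (h u) (h t) < 1 / (2 * Suc n)"
      and c: "c < t" "\<And>u. u \<in> {c<..<t} \<Longrightarrow> dist (h u) l < 1 / (2 * Suc n)"
      unfolding eventually_at_right_field eventually_at_left_field by auto
    \<comment> \<open>The point \<open>t\<close> itself is left out: it may belong to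
      \<open>osc n\<close> when the two one-sided limits differ.\<close>
    have "u \<notin> osc n" if "u \<in> {c<..<b}" "u \<noteq> t" for u
      using that near[of u t b "h t" n] b(2) near[of u c t l n] c(2) by (cases "u < t") auto
    thus ?thesis
      unfolding islimpt_def using b(1) c(1)
      by (intro notI) (drule spec[of _ "{c<..<b}"], auto)
  qed
  hence "countable (osc n)" for n by (rule no_limpt_imp_countable)
  hence "countable (\<Union>n. osc n)" by auto
  moreover have "discont h \<subseteq> (\<Union>n. osc n)"
  proof
    fix t assume "t \<in> discont h"
    hence "\<not> isCont h t" by (simp add: discont_def)
    then obtain n where "t \<in> osc n"
      using isCont_if_small_oscillation[of t h] unfolding osc_def mem_Collect_eq by metis
    thus "t \<in> (\<Union>n. osc n)" by blast
  qed
  ultimately show ?thesis by (rule countable_subset[rotated])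
qed

section \<open>Local integrability and oriented primitives\<close>

definition loc_integrable :: "(real \<Rightarrow> 'a::euclidean_space) \<Rightarrow> bool" where
  "loc_integrable g \<longleftrightarrow> (\<forall>c d. set_integrable lborel {c..d} g)"

definition primitive :: "(real \<Rightarrow> 'a::euclidean_space) \<Rightarrow> real \<Rightarrow> 'a" where
  "primitive g t = interval_lebesgue_integral lborel (ereal 0) (ereal t) g"

text \<open>Interval integrals live on open intervals, whereas local integrability is stated on
  closed ones; the endpoints form a null set.\<close>

lemma set_integrable_Icc_iff_Ioo:
  fixes g :: "real \<Rightarrow> 'a::euclidean_space"
  shows "set_integrable lborel {c..d} g \<longleftrightarrow> set_integrable lborel {c<..<d} g"
proof
  assume "set_integrable lborel {c<..<d} g"
  moreover have "set_integrable lborel {c, d} g"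
    by (rule set_integrable_discrete_difference[where X="{c,d}" and A="{}", THEN iffD1])
      (auto simp: set_integrable_def)
  ultimately have "set_integrable lborel ({c<..<d} \<union> {c, d}) g"
    by (rule set_integrable_Un) auto
  thus "set_integrable lborel {c..d} g" by (rule set_integrable_subset) auto
qed (rule set_integrable_subset, auto)

lemma loc_integrable_iff_interval:
  "loc_integrable g \<longleftrightarrow> (\<forall>t. interval_lebesgue_integrable lborel (ereal 0) (ereal t) g)"
proof
  assume "loc_integrable g"
  thus "\<forall>t. interval_lebesgue_integrable lborel (ereal 0) (ereal t) g"
    by (auto simp: loc_integrable_def interval_lebesgue_integrable_def zero_ereal_def
        intro: set_integrable_subset[OF _ _ greaterThanLessThan_subseteq_atLeastAtMost_iff[THEN iffD2]])
next
  assume *: "\<forall>t. interval_lebesgue_integrable lborel (ereal 0) (ereal t) g"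
  have Icc: "set_integrable lborel {0..t} g" "set_integrable lborel {-t..0} g" if "t \<ge> 0" for t
    using *[rule_format, of t] *[rule_format, of "-t"] that unfolding set_integrable_Icc_iff_Ioo
    by (cases "t = 0"; auto simp: interval_lebesgue_integrable_def zero_ereal_def)+
  have "set_integrable lborel {c..d} g" for c d
  proof (rule set_integrable_subset)
    show "set_integrable lborel ({- \<bar>c\<bar> ..0} \<union> {0..\<bar>d\<bar>}) g"
      by (intro set_integrable_Un Icc) auto
  qed auto
  thus "loc_integrable g" by (simp add: loc_integrable_def)
qed

lemma loc_integrable_integrable_on: "loc_integrable g \<Longrightarrow> g integrable_on {c..d}"
  by (simp add: loc_integrable_def set_borel_integral_eq_integral)

lemma primitive_pos: "loc_integrable g \<Longrightarrow> 0 \<le> t \<Longrightarrow> primitive g t = integral {0..t} g"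
  unfolding primitive_def loc_integrable_def by (intro interval_integral_eq_integral) auto

lemma primitive_neg: "loc_integrable g \<Longrightarrow> t \<le> 0 \<Longrightarrow> primitive g t = - integral {t..0} g"
  unfolding primitive_def loc_integrable_def
  by (subst interval_integral_endpoints_reverse) (simp add: interval_integral_eq_integral)

lemma primitive_0 [simp]: "primitive g 0 = 0"
  by (simp add: primitive_def)

text \<open>Moves the base point from 0 to some \<open>c\<close> left of both 0 and
  \<open>t\<close>, so that the oriented primitive becomes an ordinary indefinite integral up to a
  constant. Continuity and differentiability across 0 then need no case distinction.\<close>

lemma primitive_shift:
  assumes g: "loc_integrable g" and "c \<le> 0" "c \<le> t"
  shows "primitive g t = integral {c..t} g - integral {c..0} g"
proof (cases "0 \<le> t")
  case True
  have "integral {c..0} g + integral {0..t} g = integral {c..t} g"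
    using assms True by (intro Henstock_Kurzweil_Integration.integral_combine loc_integrable_integrable_on) auto
  with True g show ?thesis by (simp add: primitive_pos algebra_simps)
next
  case False
  have "integral {c..t} g + integral {t..0} g = integral {c..0} g"
    using assms False by (intro Henstock_Kurzweil_Integration.integral_combine loc_integrable_integrable_on) auto
  with False g show ?thesis by (simp add: primitive_neg algebra_simps)
qed

lemma continuous_primitive:
  assumes "loc_integrable g"
  shows "continuous_on UNIV (primitive g)"
proof (rule continuous_at_imp_continuous_on, rule ballI)
  fix t :: real
  \<comment> \<open>\<open>c\<close> lies below both 0 and \<open>t\<close>, as
    \<open>primitive_shift\<close> requires, and \<open>t\<close> is interior to
    \<open>{c..d}\<close>.\<close>
  define c d where "c = - \<bar>t\<bar> - 1" and "d = \<bar>t\<bar> + 1"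
  have "continuous_on {c..d} (\<lambda>x. integral {c..x} g - integral {c..0} g)"
    by (intro continuous_intros indefinite_integral_continuous_1 loc_integrable_integrable_on assms)
  hence "continuous_on {c..d} (primitive g)"
    by (rule continuous_on_eq) (auto simp: c_def intro!: primitive_shift[symmetric] assms)
  moreover have "t \<in> interior {c..d}" by (auto simp: c_def d_def)
  ultimately show "isCont (primitive g) t" by (rule continuous_on_interior)
qed

lemma primitive_has_vector_derivative:
  assumes "loc_integrable g" "isCont g t"
  shows "(primitive g has_vector_derivative g t) (at t)"
proof -
  define c d where "c = - \<bar>t\<bar> - 1" and "d = \<bar>t\<bar> + 1"
  have t: "t \<in> {c<..<d}" by (auto simp: c_def d_def)
  have "((\<lambda>u. integral {c..u} g) has_vector_derivative g t) (at t within ({c..d} - {}))"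
    using assms t
    by (intro integral_has_vector_derivative_continuous_at loc_integrable_integrable_on)
      (auto intro: continuous_at_imp_continuous_at_within)
  hence "((\<lambda>u. integral {c..u} g) has_vector_derivative g t) (at t within {c<..<d})"
    by (rule has_vector_derivative_within_subset) auto
  hence "((\<lambda>u. integral {c..u} g - integral {c..0} g) has_vector_derivative g t) (at t within {c<..<d})"
    by (auto intro!: derivative_eq_intros)
  hence "(primitive g has_vector_derivative g t) (at t within {c<..<d})"
    by (rule has_vector_derivative_transform[OF t, rotated])
      (auto simp: c_def intro!: primitive_shift assms)
  thus ?thesis using t by (simp add: at_within_open[OF t])
qed

text \<open>Under these hypotheses \<open>x - primitive g\<close> is continuous with derivative zero
  off \<open>D\<close>, hence constant. This is the passage from a differential equation back to its
  integral form; the countable exceptional set takes the place of an argument by absolute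
  continuity.\<close>

lemma eq_primitive_if_deriv_off_countable:
  assumes "countable D" "loc_integrable g" "continuous_on UNIV x"
    and "\<And>t. t \<notin> D \<Longrightarrow> isCont g t" "\<And>t. t \<notin> D \<Longrightarrow> (x has_vector_derivative g t) (at t)"
  shows "x t = x 0 + primitive g t"
proof -
  have "x t - primitive g t = x 0 - primitive g 0"
  proof (rule constant_if_deriv_zero_off_countable[OF assms(1)])
    show "((\<lambda>t. x t - primitive g t) has_vector_derivative 0) (at t)" if "t \<notin> D" for t
      using has_vector_derivative_diff[OF assms(5)[OF that]
          primitive_has_vector_derivative[OF assms(2) assms(4)[OF that]]] by simp
  qed (intro continuous_intros assms continuous_primitive)
  thus ?thesis by (simp add: algebra_simps)
qed

text \<open>Each truncation to a bounded interval is measurable, being integrable; at a fixed point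
  the truncations are eventually equal to \<open>g\<close>.\<close>

lemma loc_integrable_measurable:
  fixes g :: "real \<Rightarrow> 'a::euclidean_space"
  assumes "loc_integrable g"
  shows "g \<in> borel_measurable borel"
proof (rule borel_measurable_LIMSEQ_metric)
  show "(\<lambda>t. indicat_real {- real n..real n} t *\<^sub>R g t) \<in> borel_measurable borel" for n
    using assms unfolding loc_integrable_def set_integrable_def
    by (metis borel_measurable_integrable measurable_lborel2)
  fix t :: real
  have "eventually (\<lambda>n. indicat_real {- real n..real n} t *\<^sub>R g t = g t) sequentially"
    using eventually_ge_at_top[of "nat \<lceil>\<bar>t\<bar>\<rceil>"]
    by eventually_elim (auto simp: indicator_def le_nat_iff split: if_splits; linarith)
  thus "(\<lambda>n. indicat_real {- real n..real n} t *\<^sub>R g t) \<longlonglongrightarrow> g t"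
    by (rule tendsto_eventually)
qed

text \<open>On a compact interval the continuous factor \<open>\<beta>\<close> is bounded, so a
  constant multiple of \<open>z\<close> dominates \<open>g\<close>. The term
  \<open>zeta \<omega> r *\<^sub>R s r\<close> of the random equation is of this kind.\<close>

lemma loc_integrable_bound:
  fixes g :: "real \<Rightarrow> 'a::euclidean_space" and z :: "real \<Rightarrow> 'b::euclidean_space"
  assumes "loc_integrable z" "g \<in> borel_measurable borel" "continuous_on UNIV \<beta>"
    and bound: "\<And>t. norm (g t) \<le> \<beta> t * norm (z t)"
  shows "loc_integrable g"
  unfolding loc_integrable_def
proof (intro allI)
  fix c d :: real
  have "bounded (\<beta> ` {c..d})"
    by (intro compact_imp_bounded compact_continuous_image continuous_on_subset[OF assms(3)]) auto
  then obtain M where M: "\<And>t. t \<in> {c..d} \<Longrightarrow> norm (\<beta> t) \<le> M"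
    unfolding bounded_iff by (metis imageI)
  have z: "integrable lborel (\<lambda>t. M *\<^sub>R (indicat_real {c..d} t *\<^sub>R z t))"
    using assms(1) unfolding loc_integrable_def set_integrable_def
    by (intro Bochner_Integration.integrable_scaleR_right) auto
  show "set_integrable lborel {c..d} g"
    unfolding set_integrable_def
  proof (rule Bochner_Integration.integrable_bound[OF z])
    show "(\<lambda>t. indicat_real {c..d} t *\<^sub>R g t) \<in> borel_measurable lborel"
      using assms(2) by auto
    have "norm (g t) \<le> norm (M *\<^sub>R z t)" if "t \<in> {c..d}" for t
    proof -
      have "norm (g t) \<le> \<beta> t * norm (z t)" by (rule bound)
      also have "\<dots> \<le> \<bar>M\<bar> * norm (z t)" using M[OF that] by (intro mult_right_mono) auto
      finally show ?thesis by simp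
    qed
    thus "AE t in lborel. norm (indicat_real {c..d} t *\<^sub>R g t) \<le> norm (M *\<^sub>R (indicat_real {c..d} t *\<^sub>R z t))"
      by (auto simp: indicator_def)
  qed
qed

lemma loc_integrable_const: "loc_integrable (\<lambda>_. c)"
  by (simp add: loc_integrable_def borel_integrable_atLeastAtMost')

lemma loc_integrable_add:
  "loc_integrable f \<Longrightarrow> loc_integrable g \<Longrightarrow> loc_integrable (\<lambda>t. f t + g t)"
  by (simp add: loc_integrable_def)

lemma loc_integrable_continuous_bound:
  fixes g :: "real \<Rightarrow> 'a::euclidean_space"
  assumes "g \<in> borel_measurable borel" "continuous_on UNIV \<beta>" "\<And>t. norm (g t) \<le> \<beta> t"
  shows "loc_integrable g"
  by (rule loc_integrable_bound[OF loc_integrable_const[of "1::real"] assms(1,2)]) (simp add: assms(3))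

text \<open>The majorant \<open>b\<close> comes with an antiderivative \<open>\<beta>\<close>, so
  its integral is a difference of values of \<open>\<beta>\<close>; the absolute value covers both
  orientations of the segment from 0 to \<open>t\<close>.\<close>

lemma norm_primitive_le:
  fixes g :: "real \<Rightarrow> 'a::euclidean_space"
  assumes "loc_integrable g" and b: "\<And>s. (\<beta> has_real_derivative b s) (at s)"
    and bound: "\<And>s. s \<in> closed_segment 0 t \<Longrightarrow> norm (g s) \<le> b s"
  shows "norm (primitive g t) \<le> \<bar>\<beta> t - \<beta> 0\<bar>"
proof -
  have I: "(b has_integral (\<beta> d - \<beta> c)) {c..d}" if "c \<le> d" for c d
    using that b
    by (intro fundamental_theorem_of_calculus)
      (auto simp: has_real_derivative_iff_has_vector_derivative intro: has_vector_derivative_at_within)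
  have N: "norm (integral {c..d} g) \<le> \<beta> d - \<beta> c" if "c \<le> d" "{c..d} \<subseteq> closed_segment 0 t" for c d
    using I[OF that(1)] that(2) bound assms(1)
    by (metis has_integral_integrable integral_norm_bound_integral integral_unique
        loc_integrable_integrable_on subsetD)
  show ?thesis
  proof (cases "0 \<le> t")
    case True
    with N[of 0 t] show ?thesis by (simp add: primitive_pos[OF assms(1)] closed_segment_eq_real_ivl)
  next
    case False
    with N[of t 0] show ?thesis by (simp add: primitive_neg[OF assms(1)] closed_segment_eq_real_ivl)
  qed
qed

lemma primitive_bounded_linear:
  assumes "loc_integrable g" "bounded_linear T"
  shows "loc_integrable (\<lambda>s. T (g s))" "primitive (\<lambda>s. T (g s)) t = T (primitive g t)"
proof -
  interpret bounded_linear T by fact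
  have *: "set_integrable lborel S (\<lambda>s. T (g s))" if "set_integrable lborel S g" for S
    using integrable_bounded_linear[OF assms(2) that[unfolded set_integrable_def]]
    by (simp add: set_integrable_def scaleR)
  show l: "loc_integrable (\<lambda>s. T (g s))" using assms(1) * by (auto simp: loc_integrable_def)
  have "integral {c..d} (\<lambda>s. T (g s)) = T (integral {c..d} g)" for c d
    using integral_linear[OF loc_integrable_integrable_on[OF assms(1)] assms(2)] by (simp add: o_def)
  thus "primitive (\<lambda>s. T (g s)) t = T (primitive g t)"
    using assms(1) l by (cases "0 \<le> t") (auto simp: primitive_pos primitive_neg linear_neg linear_axioms)
qed

text \<open>Only values between 0 and \<open>t\<close> enter. Hence a path given on the half line
  may be replaced by any extension of it as long as \<open>t \<le> 0\<close>.\<close>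

lemma primitive_cong:
  assumes "\<And>s. s \<in> closed_segment 0 t \<Longrightarrow> f s = g s"
  shows "primitive f t = primitive g t"
    "interval_lebesgue_integrable lborel (ereal 0) (ereal t) f
      \<longleftrightarrow> interval_lebesgue_integrable lborel (ereal 0) (ereal t) g"
proof -
  have "f s = g s" if "s \<in> einterval (min (ereal 0) (ereal t)) (max (ereal 0) (ereal t))" for s
    using that assms by (auto simp: closed_segment_eq_real_ivl einterval_iff min_def max_def split: if_splits)
  thus "primitive f t = primitive g t" unfolding primitive_def by (rule interval_integral_cong)
  have "f s = g s" if "s \<in> einterval (ereal 0) (ereal t) \<or> s \<in> einterval (ereal t) (ereal 0)" for s
    using that assms by (auto simp: closed_segment_eq_real_ivl einterval_iff split: if_splits)
  thus "interval_lebesgue_integrable lborel (ereal 0) (ereal t) f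
      \<longleftrightarrow> interval_lebesgue_integrable lborel (ereal 0) (ereal t) g"
    unfolding interval_lebesgue_integrable_def by (metis set_integrable_cong)
qed

lemma primitive_diff:
  "loc_integrable f \<Longrightarrow> loc_integrable g \<Longrightarrow>
    primitive (\<lambda>s. f s - g s) t = primitive f t - primitive g t"
  unfolding primitive_def by (simp add: loc_integrable_iff_interval)

section \<open>The matrix exponential\<close>

text \<open>A bilinear map between finite-dimensional spaces is bounded, so linearity in each
  argument is all there is to check.\<close>

lemma bounded_bilinear_matrix_vector_mult:
  "bounded_bilinear ((*v) :: real^'n^'m \<Rightarrow> real^'n \<Rightarrow> real^'m)"
proof -
  have "bilinear ((*v) :: real^'n^'m \<Rightarrow> real^'n \<Rightarrow> real^'m)"
    unfolding bilinear_def
    by (auto intro!: linearI simp: vec_eq_iff matrix_vector_mult_def sum.distrib sum_distrib_left algebra_simps)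
  thus ?thesis by (simp add: bilinear_conv_bounded_bilinear)
qed

lemma bounded_bilinear_matrix_matrix_mult:
  "bounded_bilinear ((**) :: real^'n^'m \<Rightarrow> real^'k^'n \<Rightarrow> real^'k^'m)"
proof -
  have "bilinear ((**) :: real^'n^'m \<Rightarrow> real^'k^'n \<Rightarrow> real^'k^'m)"
    unfolding bilinear_def
    by (auto intro!: linearI simp: vec_eq_iff matrix_matrix_mult_def sum.distrib sum_distrib_left algebra_simps)
  thus ?thesis by (simp add: bilinear_conv_bounded_bilinear)
qed

lemma matpow_scaleR: "matpow (t *\<^sub>R M) k = t ^ k *\<^sub>R matpow M k"
  by (induction k)
    (simp_all add: bounded_bilinear.scaleR_left[OF bounded_bilinear_matrix_matrix_mult]
      bounded_bilinear.scaleR_right[OF bounded_bilinear_matrix_matrix_mult])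

lemma matpow_commute: "M ** matpow M k = matpow M k ** M"
  by (induction k) (simp, metis matpow.simps(2) matrix_mul_assoc)

text \<open>The bilinear product is bounded with some constant \<open>K\<close>, so powers grow at
  most like those of \<open>norm M * K\<close>. The factor \<open>norm (mat 1)\<close> enters at
  exponent 0, since the Euclidean norm of the identity matrix is not 1 in general.\<close>

lemma matpow_norm_bound: "\<exists>c\<ge>0. \<forall>k. norm (matpow (M :: real^'n^'n) k) \<le> norm (mat 1 :: real^'n^'n) * c ^ k"
proof -
  obtain K where K: "\<And>(x :: real^'n^'n) (y :: real^'n^'n). norm (x ** y) \<le> norm x * norm y * K" "K > 0"
    using bounded_bilinear.pos_bounded[OF bounded_bilinear_matrix_matrix_mult] by blast
  have "norm (matpow M k) \<le> norm (mat 1 :: real^'n^'n) * (norm M * K) ^ k" for k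
  proof (induction k)
    case (Suc k)
    have "norm (matpow M (Suc k)) \<le> norm M * norm (matpow M k) * K"
 using K(1)[of M "matpow M k"] by simp
    also have "\<dots> = (norm M * K) * norm (matpow M k)" by (simp add: mult_ac)
    also have "\<dots> \<le> (norm M * K) * (norm (mat 1 :: real^'n^'n) * (norm M * K) ^ k)"
      using K(2) by (intro mult_left_mono Suc) auto
    finally show ?case by (simp add: mult_ac)
  qed simp
  thus ?thesis using K(2) by (intro exI[of _ "norm M * K"]) auto
qed

lemma mat_exp_summable: "summable (\<lambda>k. norm ((1 / fact k) *\<^sub>R matpow (M :: real^'n^'n) k))"
proof -
  obtain c where c: "c \<ge> 0" "\<And>k. norm (matpow M k) \<le> norm (mat 1 :: real^'n^'n) * c ^ k"
    using matpow_norm_bound[of M] by blast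
  have "summable (\<lambda>k. norm (mat 1 :: real^'n^'n) * (c ^ k /\<^sub>R fact k))"
    by (intro summable_mult summable_exp_generic)
  thus ?thesis
  proof (rule summable_comparison_test[rotated], intro exI allI impI)
    fix k
    have "norm (matpow M k) / fact k \<le> norm (mat 1 :: real^'n^'n) * c ^ k / fact k"
      by (intro divide_right_mono c) simp
    thus "norm (norm ((1 / fact k) *\<^sub>R matpow M k)) \<le> norm (mat 1 :: real^'n^'n) * (c ^ k /\<^sub>R fact k)"
      by (simp add: divide_inverse mult_ac)
  qed
qed

lemma bounded_linear_entry: "bounded_linear (\<lambda>M :: real^'n^'m. M $ i $ j)"
  using bounded_linear_compose[OF bounded_linear_vec_nth bounded_linear_vec_nth] .

text \<open>Each entry is an ordinary real power series in \<open>t\<close>, so termwise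
  differentiation of real power series becomes available.\<close>

lemma mat_exp_entry:
  "mat_exp (t *\<^sub>R M) $ i $ j = (\<Sum>k. (matpow M k $ i $ j / fact k) * t ^ k)"
  "summable (\<lambda>k. (matpow M k $ i $ j / fact k) * t ^ k)"
proof -
  have s: "summable (\<lambda>k. (1 / fact k) *\<^sub>R matpow (t *\<^sub>R M) k)"
    by (rule summable_norm_cancel[OF mat_exp_summable])
  show "summable (\<lambda>k. (matpow M k $ i $ j / fact k) * t ^ k)"
    using bounded_linear.summable[OF bounded_linear_entry s, of i j]
    by (simp add: matpow_scaleR mult_ac)
  show "mat_exp (t *\<^sub>R M) $ i $ j = (\<Sum>k. (matpow M k $ i $ j / fact k) * t ^ k)"
    using bounded_linear.suminf[OF bounded_linear_entry s, of i j]
    by (simp add: mat_exp_def matpow_scaleR mult_ac)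
qed

lemma mat_exp_0 [simp]: "mat_exp 0 = mat 1"
proof -
  have "(1 / fact k) *\<^sub>R matpow (0 :: real^'n^'n) k = 0" if "k \<noteq> 0" for k
    using that by (cases k) auto
  hence "mat_exp (0 :: real^'n^'n) = (\<Sum>k\<in>{0}. (1 / fact k) *\<^sub>R matpow (0 :: real^'n^'n) k)"
    unfolding mat_exp_def by (intro suminf_finite) auto
  thus ?thesis by simp
qed

lemma has_vector_derivative_vec:
  fixes f :: "real \<Rightarrow> 'a::euclidean_space^'n"
  assumes "\<And>i. ((\<lambda>t. f t $ i) has_vector_derivative f' $ i) (at t)"
  shows "(f has_vector_derivative f') (at t)"
  unfolding has_vector_derivative_def has_derivative_componentwise_within[of f]
proof
  fix b :: "'a^'n" assume "b \<in> Basis"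
  then obtain i u where b: "b = axis i u" by (auto simp: Basis_vec_def)
  have "((\<lambda>t. f t $ i \<bullet> u) has_derivative (\<lambda>h. (h *\<^sub>R f' $ i) \<bullet> u)) (at t)"
    using assms[of i] unfolding has_vector_derivative_def by (rule has_derivative_inner_left)
  thus "((\<lambda>t. f t \<bullet> b) has_derivative (\<lambda>h. (h *\<^sub>R f') \<bullet> b)) (at t)"
    by (simp add: b inner_axis)
qed

lemma mat_exp_commute: "M ** mat_exp (t *\<^sub>R M) = mat_exp (t *\<^sub>R M) ** M"
proof -
  have s: "summable (\<lambda>k. (1 / fact k) *\<^sub>R matpow (t *\<^sub>R M) k)"
    by (rule summable_norm_cancel[OF mat_exp_summable])
  note bb = bounded_bilinear_matrix_matrix_mult
  show ?thesis
    unfolding mat_exp_def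
      bounded_linear.suminf[OF bounded_bilinear.bounded_linear_right[OF bb] s]
      bounded_linear.suminf[OF bounded_bilinear.bounded_linear_left[OF bb] s]
    by (simp add: matpow_scaleR bounded_bilinear.scaleR_left[OF bb]
        bounded_bilinear.scaleR_right[OF bb] matpow_commute)
qed

lemma mat_exp_has_vector_derivative:
  "((\<lambda>t. mat_exp (t *\<^sub>R M)) has_vector_derivative M ** mat_exp (t *\<^sub>R M)) (at t)"
proof (rule has_vector_derivative_vec)+
  fix i j
  define c where "c k = matpow M k $ i $ j / fact k" for k
  have "((\<lambda>t. mat_exp (t *\<^sub>R M) $ i $ j) has_real_derivative (\<Sum>k. diffs c k * t ^ k)) (at t)"
    unfolding mat_exp_entry c_def[symmetric]
    by (rule termdiffs_strong_converges_everywhere) (use mat_exp_entry(2) in \<open>simp add: c_def\<close>)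
  also have "(\<Sum>k. diffs c k * t ^ k) = (\<Sum>k. \<Sum>l\<in>UNIV. M $ i $ l * ((matpow M k $ l $ j / fact k) * t ^ k))"
  proof (rule suminf_cong)
    fix k
    \<comment> \<open>The shifted coefficient carries the factor \<open>Suc k\<close>, which cancels
      one factor of \<open>fact (Suc k)\<close>; the extra factor \<open>M\<close> is then split off
      as a finite sum over \<open>l\<close>.\<close>
    have "diffs c k = matpow M (Suc k) $ i $ j / fact k"
      unfolding diffs_def c_def by (simp del: matpow.simps)
    also have "\<dots> = (\<Sum>l\<in>UNIV. M $ i $ l * (matpow M k $ l $ j / fact k))"
      by (simp add: matrix_matrix_mult_def sum_divide_distrib)
    finally show "diffs c k * t ^ k = (\<Sum>l\<in>UNIV. M $ i $ l * ((matpow M k $ l $ j / fact k) * t ^ k))"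
      by (simp add: sum_distrib_right mult.assoc)
  qed
  also have "\<dots> = (\<Sum>l\<in>UNIV. \<Sum>k. M $ i $ l * ((matpow M k $ l $ j / fact k) * t ^ k))"
    by (rule suminf_sum) (intro summable_mult mat_exp_entry)
  also have "\<dots> = (\<Sum>l\<in>UNIV. M $ i $ l * mat_exp (t *\<^sub>R M) $ l $ j)"
    by (simp only: mat_exp_entry suminf_mult[OF mat_exp_entry(2)])
  also have "\<dots> = (M ** mat_exp (t *\<^sub>R M)) $ i $ j"
    by (simp add: matrix_matrix_mult_def)
  finally show "((\<lambda>t. mat_exp (t *\<^sub>R M) $ i $ j) has_vector_derivative (M ** mat_exp (t *\<^sub>R M)) $ i $ j) (at t)"
    by (simp add: has_real_derivative_iff_has_vector_derivative)
qed

lemma mat_exp_neg_has_vector_derivative: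
  "((\<lambda>t. mat_exp (- t *\<^sub>R M)) has_vector_derivative - (M ** mat_exp (- t *\<^sub>R M))) (at t)"
proof -
  have "(uminus has_vector_derivative (-1)) (at t)"
    by (auto intro!: derivative_eq_intros)
  from vector_diff_chain_at[OF this mat_exp_has_vector_derivative] show ?thesis
    by (simp add: o_def)
qed

text \<open>With \<open>s\<close> fixed the product is constant in \<open>t\<close>: the two terms
  of the product rule cancel because \<open>M\<close> commutes with its exponential. The value at
  \<open>t = 0\<close> is the right-hand side. The group law follows without multiplying
  series.\<close>

lemma mat_exp_minus_mult: "mat_exp (- t *\<^sub>R M) ** mat_exp ((t + s) *\<^sub>R M) = mat_exp (s *\<^sub>R M)"
proof -
  have d2: "((\<lambda>t. mat_exp ((t + s) *\<^sub>R M)) has_vector_derivative M ** mat_exp ((t + s) *\<^sub>R M)) (at t)" for t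
  proof -
    have "((\<lambda>t. t + s) has_vector_derivative 1) (at t)"
      by (auto intro!: derivative_eq_intros)
    from vector_diff_chain_at[OF this mat_exp_has_vector_derivative] show ?thesis
      by (simp add: o_def)
  qed
  have "((\<lambda>t. mat_exp (- t *\<^sub>R M) ** mat_exp ((t + s) *\<^sub>R M)) has_vector_derivative 0) (at t)" for t
    using bounded_bilinear.has_vector_derivative[OF bounded_bilinear_matrix_matrix_mult
        mat_exp_neg_has_vector_derivative[of M t] d2[of t]]
    by (simp add: bounded_bilinear.minus_left[OF bounded_bilinear_matrix_matrix_mult]
        mat_exp_commute[of M "- t", simplified] matrix_mul_assoc)
  then obtain c where "\<And>t. mat_exp (- t *\<^sub>R M) ** mat_exp ((t + s) *\<^sub>R M) = c"
    using has_vector_derivative_zero_constant[of UNIV "\<lambda>t. mat_exp (- t *\<^sub>R M) ** mat_exp ((t + s) *\<^sub>R M)"]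
    by auto
  from this[of t] this[of 0] show ?thesis by simp
qed

lemma mat_exp_add: "mat_exp ((t + s) *\<^sub>R M) = mat_exp (t *\<^sub>R M) ** mat_exp (s *\<^sub>R M)"
proof -
  have "mat_exp (t *\<^sub>R M) ** mat_exp (- t *\<^sub>R M) = mat 1"
    using mat_exp_minus_mult[of "- t" M 0] mat_exp_minus_mult[of "- t" M t] by simp
  thus ?thesis
    using mat_exp_minus_mult[of t M s] by (metis matrix_mul_assoc matrix_mul_lid)
qed

text \<open>Separates the dependence on \<open>t\<close> from that on \<open>s\<close>, so that the
  factor with \<open>t\<close> can be taken out of an integral over \<open>s\<close>.\<close>

lemma mat_exp_diff_vec: "mat_exp ((t - s) *\<^sub>R M) *v x = mat_exp (t *\<^sub>R M) *v (mat_exp (- s *\<^sub>R M) *v x)"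
  using mat_exp_add[of t "-s" M] by (simp add: matrix_vector_mul_assoc)

lemma mat_exp_inverse_vec: "mat_exp (t *\<^sub>R M) *v (mat_exp (- t *\<^sub>R M) *v x) = x"
  using mat_exp_diff_vec[of t t M x] by simp

lemma mat_exp_inverse_vec': "mat_exp (- t *\<^sub>R M) *v (mat_exp (t *\<^sub>R M) *v x) = x"
  using mat_exp_inverse_vec[of "- t" M x] by simp

lemma continuous_mat_exp: "continuous_on UNIV (\<lambda>t. mat_exp (t *\<^sub>R M))"
  using mat_exp_has_vector_derivative
  by (metis continuous_at_imp_continuous_on has_vector_derivative_continuous)

lemma continuous_on_matrix_vector_mult [continuous_intros]:
  fixes f :: "'a::topological_space \<Rightarrow> real^'n^'m"
  shows "continuous_on S f \<Longrightarrow> continuous_on S g \<Longrightarrow> continuous_on S (\<lambda>x. f x *v g x)"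
  by (rule bounded_bilinear.continuous_on[OF bounded_bilinear_matrix_vector_mult])

lemma continuous_mat_exp_vec [continuous_intros]:
  fixes f :: "'a::topological_space \<Rightarrow> real"
  shows "continuous_on S f \<Longrightarrow> continuous_on S g \<Longrightarrow> continuous_on S (\<lambda>x. mat_exp (f x *\<^sub>R M) *v g x)"
  by (intro continuous_on_matrix_vector_mult continuous_on_compose2[OF continuous_mat_exp]) auto

lemma borel_measurable_mat_exp_vec:
  assumes "f \<in> borel_measurable N" "g \<in> borel_measurable N"
  shows "(\<lambda>s. mat_exp (f s *\<^sub>R M) *v g s) \<in> borel_measurable N"
  by (rule borel_measurable_continuous_Pair[OF assms, where H="\<lambda>u x. mat_exp (u *\<^sub>R M) *v x"])
    (intro continuous_intros)

lemma mat_exp_vec_has_vector_derivative: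
  assumes "(x has_vector_derivative x') (at t)"
  shows "((\<lambda>t. mat_exp (t *\<^sub>R M) *v x t) has_vector_derivative
    (M *v (mat_exp (t *\<^sub>R M) *v x t) + mat_exp (t *\<^sub>R M) *v x')) (at t)"
  using bounded_bilinear.has_vector_derivative[OF bounded_bilinear_matrix_vector_mult
      mat_exp_has_vector_derivative assms]
  by (simp add: matrix_vector_mul_assoc add.commute)

text \<open>The integrating factor: if \<open>x'\<close> equals \<open>M *v x t + y\<close>, the
  derivative is \<open>mat_exp (- t *\<^sub>R M) *v y\<close> and no longer involves
  \<open>x\<close>.\<close>

lemma mat_exp_neg_vec_has_vector_derivative:
  assumes "(x has_vector_derivative x') (at t)"
  shows "((\<lambda>t. mat_exp (- t *\<^sub>R M) *v x t) has_vector_derivative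
    mat_exp (- t *\<^sub>R M) *v (x' - M *v x t)) (at t)"
proof -
  note bb = bounded_bilinear_matrix_vector_mult
  show ?thesis
    using bounded_bilinear.has_vector_derivative[OF bb mat_exp_neg_has_vector_derivative[of M t] assms]
    by (simp add: matrix_vector_mul_assoc bounded_bilinear.minus_left[OF bb]
        bounded_bilinear.diff_right[OF bb] mat_exp_commute[of M "-t", simplified])
qed

section \<open>Contractions in weighted sup norms and Caratheodory flows\<close>

text \<open>The Lipschitz hypothesis on the nonlinearities measures pairs by the sum of the two
  norms. With this norm the components of the Lyapunov-Perron operator contribute
  \<open>K / (a - \<eta>)\<close> and \<open>K / (\<eta> - b)\<close>, whose sum is exactly the gap
  quantity; the product norm would distort the constants.\<close>

definition sum_norm :: "'a::real_normed_vector \<times> 'b::real_normed_vector \<Rightarrow> real" where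
  "sum_norm p = norm (fst p) + norm (snd p)"

lemma sum_norm_nonneg [simp]: "0 \<le> sum_norm p"
  by (simp add: sum_norm_def)

lemma sum_norm_0 [simp]: "sum_norm 0 = 0"
  by (simp add: sum_norm_def)

lemma sum_norm_eq_0_iff [simp]: "sum_norm p = 0 \<longleftrightarrow> p = 0"
  by (auto simp: sum_norm_def prod_eq_iff add_nonneg_eq_0_iff)

lemma norm_le_sum_norm: "norm p \<le> sum_norm p"
  unfolding sum_norm_def using norm_Pair_le[of "fst p" "snd p"] by simp

lemma sum_norm_le_2_norm: "sum_norm p \<le> 2 * norm p"
  unfolding sum_norm_def using norm_fst_le[of "fst p" "snd p"] norm_snd_le[of "snd p" "fst p"] by simp

lemma sum_norm_triangle: "sum_norm (p + q) \<le> sum_norm p + sum_norm q"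
  unfolding sum_norm_def using norm_triangle_ineq[of "fst p" "fst q"] norm_triangle_ineq[of "snd p" "snd q"]
  by simp

lemma sum_norm_diff_triangle: "sum_norm (p - r) \<le> sum_norm (p - q) + sum_norm (q - r)"
  using sum_norm_triangle[of "p - q" "q - r"] by simp

lemma sum_norm_minus_le: "sum_norm (p - q) \<le> sum_norm p + sum_norm q"
  unfolding sum_norm_def using norm_triangle_ineq4[of "fst p" "fst q"] norm_triangle_ineq4[of "snd p" "snd q"]
  by simp

lemma continuous_on_sum_norm [continuous_intros]:
  "continuous_on S f \<Longrightarrow> continuous_on S (\<lambda>x. sum_norm (f x))"
  unfolding sum_norm_def by (intro continuous_intros)

lemma sum_norm_tendsto [tendsto_intros]:
  "(f \<longlongrightarrow> l) F \<Longrightarrow> ((\<lambda>x. sum_norm (f x)) \<longlongrightarrow> sum_norm l) F"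
  unfolding sum_norm_def by (intro tendsto_intros)

text \<open>Covers uniqueness of fixed points of a contraction (\<open>d = 0\<close>) as well as their dependence on parameters.\<close>
lemma bound_by_contraction:
  fixes h :: "'a \<Rightarrow> real"
  assumes \<rho>: "0 \<le> \<rho>" "\<rho> < 1" and M: "\<And>t. t \<in> I \<Longrightarrow> h t \<le> M"
    and step: "\<And>M t. (\<And>t. t \<in> I \<Longrightarrow> h t \<le> M) \<Longrightarrow> t \<in> I \<Longrightarrow> h t \<le> d + \<rho> * M"
    and "t \<in> I"
  shows "h t \<le> d / (1 - \<rho>)"
proof -
  define e where "e = d / (1 - \<rho>)"
  \<comment> \<open>The iterates of the affine map sending \<open>r\<close> to
    \<open>d + \<rho> * r\<close>, started at \<open>M\<close> and written around its fixed point
    \<open>e\<close>.\<close>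
  define m where "m n = e + \<rho> ^ n * (M - e)" for n
  have d: "d = (1 - \<rho>) * e" using \<rho> by (simp add: e_def)
  have m: "d + \<rho> * m n = m (Suc n)" for n
    unfolding d m_def by (simp add: algebra_simps)
  have "\<forall>t\<in>I. h t \<le> m n" for n
  proof (induction n)
    case (Suc n) thus ?case using step[of "m n"] by (simp add: m)
  qed (use M in \<open>simp add: m_def\<close>)
  moreover have "m \<longlonglongrightarrow> e + 0 * (M - e)"
    unfolding m_def using \<rho> by (intro tendsto_intros LIMSEQ_realpow_zero)
  ultimately show ?thesis using \<open>t \<in> I\<close> LIMSEQ_le_const[of m] by (simp add: e_def)
qed

definition weighted_bounded :: "real set \<Rightarrow> (real \<Rightarrow> real) \<Rightarrow>
    (real \<Rightarrow> 'a::real_normed_vector \<times> 'b::real_normed_vector) \<Rightarrow> bool" where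
  "weighted_bounded I w \<Phi> \<longleftrightarrow> continuous_on I \<Phi> \<and> (\<exists>C. \<forall>t\<in>I. w t * sum_norm (\<Phi> t) \<le> C)"

text \<open>Banach's fixed point theorem for a space given by a predicate: the steps between Picard
  iterates of the zero path decay geometrically in the weighted norm. The contraction is assumed for
  every upper bound \<open>M\<close> of the weighted distance, so no supremum is ever formed. The
  set \<open>I\<close> will be the whole line for orbits and the half line for the Lyapunov-Perron
  operator.\<close>

lemma weighted_fixed_point:
  fixes T :: "(real \<Rightarrow> 'a::euclidean_space \<times> 'b::euclidean_space) \<Rightarrow> real \<Rightarrow> 'a \<times> 'b"
  assumes w: "continuous_on I w" "\<And>t. t \<in> I \<Longrightarrow> w t > 0" and \<rho>: "0 \<le> \<rho>" "\<rho> < 1"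
    and inv: "\<And>\<Phi>. weighted_bounded I w \<Phi> \<Longrightarrow> weighted_bounded I w (T \<Phi>)"
    and contr: "\<And>\<Phi> \<Psi> M t. weighted_bounded I w \<Phi> \<Longrightarrow> weighted_bounded I w \<Psi> \<Longrightarrow>
      (\<And>t. t \<in> I \<Longrightarrow> w t * sum_norm (\<Phi> t - \<Psi> t) \<le> M) \<Longrightarrow> t \<in> I \<Longrightarrow>
      w t * sum_norm (T \<Phi> t - T \<Psi> t) \<le> \<rho> * M"
  shows "\<exists>\<Phi>. weighted_bounded I w \<Phi> \<and> (\<forall>t\<in>I. \<Phi> t = T \<Phi> t)"
proof -
  define X where "X n = (T ^^ n) (\<lambda>_. 0)" for n
  have X_Suc: "X (Suc n) = T (X n)" for n by (simp add: X_def)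
  have wb: "weighted_bounded I w (X n)" for n
  proof (induction n)
    case 0 thus ?case by (auto simp: X_def weighted_bounded_def)
  qed (simp add: X_Suc inv)
  obtain M where M: "\<And>t. t \<in> I \<Longrightarrow> w t * sum_norm (X 1 t) \<le> M"
    using wb[of 1] unfolding weighted_bounded_def by blast
  have step: "t \<in> I \<Longrightarrow> w t * sum_norm (X (Suc n) t - X n t) \<le> \<rho> ^ n * M" for t n
  proof (induction n arbitrary: t)
    case 0 thus ?case using M by (simp add: X_def)
  next
    case (Suc n)
    have "w t * sum_norm (T (X (Suc n)) t - T (X n) t) \<le> \<rho> * (\<rho> ^ n * M)"
      by (rule contr[OF wb wb Suc.IH Suc.prems])
    thus ?case by (simp add: X_Suc mult_ac)
  qed
  define c where "c n = \<rho> ^ n * M / (1 - \<rho>)" for n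
  \<comment> \<open>The factor \<open>1 - \<rho> ^ k\<close> makes the bound the exact partial
    geometric sum, which is what the induction over \<open>k\<close> needs.\<close>
  have far: "w t * sum_norm (X (n + k) t - X n t) \<le> c n * (1 - \<rho> ^ k)" if "t \<in> I" for t n k
  proof (induction k)
    case (Suc k)
    have "w t * sum_norm (X (n + Suc k) t - X n t)
        \<le> w t * (sum_norm (X (Suc (n + k)) t - X (n + k) t) + sum_norm (X (n + k) t - X n t))"
      using w(2)[OF that] sum_norm_diff_triangle[of "X (Suc (n + k)) t" "X n t" "X (n + k) t"]
      by (intro mult_left_mono) auto
    also have "\<dots> \<le> \<rho> ^ (n + k) * M + c n * (1 - \<rho> ^ k)"
      using step[OF that, of "n + k"] Suc by (simp add: algebra_simps)
    also have "\<dots> = c n * (1 - \<rho> ^ Suc k)"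
      using \<rho> by (simp add: c_def field_simps power_add)
    finally show ?case .
  qed simp
  have "M \<ge> 0" if "t \<in> I" for t
    using M[OF that] w(2)[OF that] by (smt (verit) mult_nonneg_nonneg sum_norm_nonneg)
  hence c_nonneg: "c n \<ge> 0" if "t \<in> I" for t n using \<rho> that by (auto simp: c_def)
  have far': "w t * sum_norm (X m t - X n t) \<le> c n" if "t \<in> I" "n \<le> m" for t n m
    using far[OF that(1), of n "m - n"] that(2) c_nonneg[OF that(1), of n] \<rho>
      mult_left_mono[of "1 - \<rho> ^ (m - n)" 1 "c n"] by simp
  have c0: "c \<longlonglongrightarrow> 0"
  proof -
    have "c \<longlonglongrightarrow> 0 * M / (1 - \<rho>)"
      unfolding c_def using \<rho> by (intro tendsto_intros LIMSEQ_realpow_zero) auto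
    thus ?thesis by simp
  qed
  have conv: "convergent (\<lambda>n. X n t)" if "t \<in> I" for t
  proof -
    have "Cauchy (\<lambda>n. X n t)"
    proof (rule metric_CauchyI)
      fix e :: real assume "e > 0"
      hence "e * w t / 2 > 0" using w(2)[OF that] by simp
      with c0 have "eventually (\<lambda>n. c n < e * w t / 2) sequentially" by (rule order_tendstoD)
      then obtain N where N: "c N < e * w t / 2" by (auto simp: eventually_sequentially)
      have near: "norm (X n t - X N t) < e / 2" if "n \<ge> N" for n
      proof -
        have "w t * norm (X n t - X N t) \<le> w t * sum_norm (X n t - X N t)"
          using w(2)[OF \<open>t \<in> I\<close>] by (intro mult_left_mono norm_le_sum_norm) auto
        also have "\<dots> < w t * (e / 2)" using far'[OF \<open>t \<in> I\<close> that] N by (simp add: mult_ac)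
        finally show ?thesis using w(2)[OF \<open>t \<in> I\<close>] by simp
      qed
      have "dist (X m t) (X n t) < e" if "m \<ge> N" "n \<ge> N" for m n
        using near[OF that(1)] near[OF that(2)]
        by (metis dist_norm dist_commute dist_triangle_half_r)
      thus "\<exists>N. \<forall>m\<ge>N. \<forall>n\<ge>N. dist (X m t) (X n t) < e" by blast
    qed
    thus ?thesis by (rule Cauchy_convergent)
  qed
  define L where "L t = lim (\<lambda>n. X n t)" for t
  have L: "(\<lambda>n. X n t) \<longlonglongrightarrow> L t" if "t \<in> I" for t
    using conv[OF that] by (simp add: L_def convergent_LIMSEQ_iff)
  have LX: "w t * sum_norm (L t - X n t) \<le> c n" if "t \<in> I" for t n
  proof (rule LIMSEQ_le_const2)
    show "(\<lambda>m. w t * sum_norm (X m t - X n t)) \<longlonglongrightarrow> w t * sum_norm (L t - X n t)"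
      by (intro tendsto_intros L that)
  qed (use far'[OF that] in blast)
  \<comment> \<open>Only the weighted iterates converge uniformly on \<open>I\<close>, because
    \<open>w\<close> may come arbitrarily close to 0; continuity of \<open>L\<close> is recovered by
    dividing by \<open>w\<close>.\<close>
  have "continuous_on I (\<lambda>t. w t *\<^sub>R L t)"
  proof (rule uniform_limit_theorem)
    show "uniform_limit I (\<lambda>n t. w t *\<^sub>R X n t) (\<lambda>t. w t *\<^sub>R L t) sequentially"
    proof (rule uniform_limitI)
      fix e :: real assume "e > 0"
      with c0 have "eventually (\<lambda>n. c n < e) sequentially" by (rule order_tendstoD)
      thus "\<forall>\<^sub>F n in sequentially. \<forall>t\<in>I. dist (w t *\<^sub>R X n t) (w t *\<^sub>R L t) < e"
      proof eventually_elim
        case (elim n)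
        show ?case
        proof
          fix t assume t: "t \<in> I"
          have "dist (w t *\<^sub>R X n t) (w t *\<^sub>R L t) = w t * norm (L t - X n t)"
            using w(2)[OF t] by (simp add: dist_norm norm_minus_commute flip: scaleR_right_diff_distrib)
          also have "\<dots> \<le> w t * sum_norm (L t - X n t)"
            using w(2)[OF t] by (intro mult_left_mono norm_le_sum_norm) auto
          also have "\<dots> < e" using LX[OF t, of n] elim by simp
          finally show "dist (w t *\<^sub>R X n t) (w t *\<^sub>R L t) < e" .
        qed
      qed
    qed
    show "\<forall>\<^sub>F n in sequentially. continuous_on I (\<lambda>t. w t *\<^sub>R X n t)"
      using wb w(1) by (intro always_eventually allI continuous_on_scaleR) (auto simp: weighted_bounded_def)
  qed simp
  hence "continuous_on I (\<lambda>t. inverse (w t) *\<^sub>R (w t *\<^sub>R L t))"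
    by (rule continuous_on_scaleR[OF continuous_on_inverse[OF w(1)], rotated]) (use w(2) in force)
  hence "continuous_on I L"
    by (rule continuous_on_eq) (use w(2) in force)
  hence wbL: "weighted_bounded I w L"
    using LX[of _ 0] by (auto simp: weighted_bounded_def X_def)
  have "L t = T L t" if t: "t \<in> I" for t
  proof -
    have TX: "w t * sum_norm (T L t - X (Suc n) t) \<le> \<rho> * c n" for n
      unfolding X_Suc by (rule contr[OF wbL wb _ t]) (rule LX)
    have "(\<lambda>n. \<rho> * c n - w t * sum_norm (T L t - X (Suc n) t))
        \<longlonglongrightarrow> \<rho> * 0 - w t * sum_norm (T L t - L t)"
      by (intro tendsto_intros c0 LIMSEQ_Suc L t)
    hence "0 \<le> \<rho> * 0 - w t * sum_norm (T L t - L t)"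
      by (rule LIMSEQ_le_const) (use TX in auto)
    hence "sum_norm (T L t - L t) \<le> 0"
      using w(2)[OF t] by (simp add: mult_le_0_iff)
    hence "sum_norm (T L t - L t) = 0" by (rule antisym) simp
    thus ?thesis by simp
  qed
  thus ?thesis using wbL by blast
qed

text \<open>Collects what is later required of a time-dependent nonlinearity. The regularity clauses
  are imposed along paths \<open>\<Phi>\<close>, because the integrands have the form
  \<open>h t (\<Phi> t)\<close>; continuity in time is asked only off the exceptional set
  \<open>D\<close>, where the jumps of the noise are collected.\<close>

definition tame :: "real set \<Rightarrow> real \<Rightarrow>
    (real \<Rightarrow> 'a::euclidean_space \<times> 'b::euclidean_space \<Rightarrow> 'c::euclidean_space) \<Rightarrow> bool" where
  "tame D K h \<longleftrightarrow>
     (\<forall>t P Q. norm (h t P - h t Q) \<le> K * sum_norm (P - Q)) \<and> (\<forall>t. h t 0 = 0) \<and>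
     (\<forall>\<Phi>. continuous_on UNIV \<Phi> \<longrightarrow> (\<lambda>t. h t (\<Phi> t)) \<in> borel_measurable borel) \<and>
     (\<forall>\<Phi> t. isCont \<Phi> t \<longrightarrow> t \<notin> D \<longrightarrow> isCont (\<lambda>t. h t (\<Phi> t)) t)"

lemma tame_lipschitz: "tame D K h \<Longrightarrow> norm (h t P - h t Q) \<le> K * sum_norm (P - Q)"
  unfolding tame_def by blast

lemma tame_norm_le: "tame D K h \<Longrightarrow> norm (h t P) \<le> K * sum_norm P"
  unfolding tame_def by (metis diff_zero)

lemma tame_nonneg: "tame D K (h :: real \<Rightarrow> 'a::euclidean_space \<times> 'b::euclidean_space \<Rightarrow> 'c::euclidean_space) \<Longrightarrow> 0 \<le> K"
proof -
  assume h: "tame D K h"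
  obtain P :: "'a \<times> 'b" where "P \<in> Basis" using nonempty_Basis by blast
  hence "P \<noteq> 0" by (rule nonzero_Basis)
  hence "sum_norm P > 0" by (simp add: order_less_le)
  moreover have "0 \<le> K * sum_norm P" using tame_norm_le[OF h, of 0 P] norm_ge_zero order_trans by blast
  ultimately show "0 \<le> K" by (simp add: zero_le_mult_iff)
qed

lemma tame_measurable: "tame D K h \<Longrightarrow> continuous_on UNIV \<Phi> \<Longrightarrow> (\<lambda>t. h t (\<Phi> t)) \<in> borel_measurable borel"
  by (simp add: tame_def)

lemma tame_isCont: "tame D K h \<Longrightarrow> continuous_on UNIV \<Phi> \<Longrightarrow> t \<notin> D \<Longrightarrow> isCont (\<lambda>t. h t (\<Phi> t)) t"
  by (simp add: tame_def continuous_on_eq_continuous_at)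

lemma tame_loc_integrable:
  assumes "tame D K h" "continuous_on UNIV \<Phi>"
  shows "loc_integrable (\<lambda>t. h t (\<Phi> t))"
  by (rule loc_integrable_continuous_bound[OF tame_measurable[OF assms], of "\<lambda>t. K * sum_norm (\<Phi> t)"])
    (intro continuous_intros assms tame_norm_le[OF assms(1)])+

text \<open>This is the nonlinearity in the equation for the difference between an orbit and the
  reference orbit \<open>S\<close>. The subtracted term cancels in differences, so \<open>K\<close>
  survives, as the gap condition demands.\<close>

lemma tame_shift:
  fixes h :: "real \<Rightarrow> 'a::euclidean_space \<times> 'b::euclidean_space \<Rightarrow> 'c::euclidean_space"
  assumes h: "tame D K h" and S: "continuous_on UNIV S"
  shows "tame D K (\<lambda>t P. h t (P + S t) - h t (S t))"
  unfolding tame_def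
proof (intro conjI allI impI)
  fix t P Q
  show "norm (h t (P + S t) - h t (S t) - (h t (Q + S t) - h t (S t))) \<le> K * sum_norm (P - Q)"
    using tame_lipschitz[OF h, of t "P + S t" "Q + S t"] by simp
next
  fix \<Phi> :: "real \<Rightarrow> 'a \<times> 'b" assume "continuous_on UNIV \<Phi>"
  thus "(\<lambda>t. h t (\<Phi> t + S t) - h t (S t)) \<in> borel_measurable borel"
    by (intro borel_measurable_diff tame_measurable[OF h] S continuous_on_add)
next
  fix \<Phi> :: "real \<Rightarrow> 'a \<times> 'b" and t assume *: "isCont \<Phi> t" "t \<notin> D"
  have "isCont S t" using S by (simp add: continuous_on_eq_continuous_at)
  have "\<And>\<Phi> t. isCont \<Phi> t \<Longrightarrow> t \<notin> D \<Longrightarrow> isCont (\<lambda>t. h t (\<Phi> t)) t"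
    using h by (auto simp: tame_def)
  from this[where \<Phi>="\<lambda>t. \<Phi> t + S t"] this[where \<Phi>=S] * \<open>isCont S t\<close>
  have "isCont (\<lambda>t. h t (\<Phi> t + S t)) t" "isCont (\<lambda>t. h t (S t)) t" by auto
  thus "isCont (\<lambda>t. h t (\<Phi> t + S t) - h t (S t)) t" by (rule isCont_diff)
qed simp

text \<open>The whole vector field is Lipschitz with a constant that includes the matrices. It
  serves existence and uniqueness of orbits; the gap condition refers to the constant
  \<open>K\<close> of the nonlinear parts alone.\<close>

lemma tame_linear_plus_Pair:
  fixes A :: "real^'n^'n" and B :: "real^'m^'m"
  assumes f: "tame D K f" and g: "tame D K g"
  shows "\<exists>L. tame D L (\<lambda>t P. (A *v fst P + f t P, B *v snd P + g t P))"
proof -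
  \<comment> \<open>Here \<open>a\<close> and \<open>b\<close> bound the linear maps
    \<open>A\<close> and \<open>B\<close>; they are not the dichotomy rates.\<close>
  obtain a where a: "\<And>x. norm (A *v x) \<le> norm x * a" "a \<ge> 0"
    using bounded_linear.nonneg_bounded[OF matrix_vector_mul_bounded_linear[of A]] by blast
  obtain b where b: "\<And>x. norm (B *v x) \<le> norm x * b" "b \<ge> 0"
    using bounded_linear.nonneg_bounded[OF matrix_vector_mul_bounded_linear[of B]] by blast
  have "tame D (a + b + 2 * K) (\<lambda>t P. (A *v fst P + f t P, B *v snd P + g t P))"
    unfolding tame_def
  proof (intro conjI allI impI)
    fix t and P Q :: "(real^'n) \<times> (real^'m)"
    let ?s = "sum_norm (P - Q)"
    have "norm (A *v fst P + f t P - (A *v fst Q + f t Q)) = norm (A *v fst (P - Q) + (f t P - f t Q))"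
      by (simp add: matrix_vector_mult_diff_distrib algebra_simps)
    also have "\<dots> \<le> norm (fst (P - Q)) * a + K * ?s"
      by (intro order_trans[OF norm_triangle_ineq] add_mono a tame_lipschitz[OF f])
    also have "norm (fst (P - Q)) * a \<le> ?s * a" using a(2) by (intro mult_right_mono) (auto simp: sum_norm_def)
    finally have 1: "norm (A *v fst P + f t P - (A *v fst Q + f t Q)) \<le> ?s * a + K * ?s" by simp
    have "norm (B *v snd P + g t P - (B *v snd Q + g t Q)) = norm (B *v snd (P - Q) + (g t P - g t Q))"
      by (simp add: matrix_vector_mult_diff_distrib algebra_simps)
    also have "\<dots> \<le> norm (snd (P - Q)) * b + K * ?s"
      by (intro order_trans[OF norm_triangle_ineq] add_mono b tame_lipschitz[OF g])
    also have "norm (snd (P - Q)) * b \<le> ?s * b" using b(2) by (intro mult_right_mono) (auto simp: sum_norm_def)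
    finally have 2: "norm (B *v snd P + g t P - (B *v snd Q + g t Q)) \<le> ?s * b + K * ?s" by simp
    show "norm ((A *v fst P + f t P, B *v snd P + g t P) - (A *v fst Q + f t Q, B *v snd Q + g t Q))
        \<le> (a + b + 2 * K) * ?s"
      using norm_le_sum_norm[of "(A *v fst P + f t P, B *v snd P + g t P) - (A *v fst Q + f t Q, B *v snd Q + g t Q)"] 1 2
      by (simp add: sum_norm_def algebra_simps)
  next
    fix \<Phi> :: "real \<Rightarrow> (real^'n) \<times> (real^'m)" assume \<Phi>: "continuous_on UNIV \<Phi>"
    have "(\<lambda>t. A *v fst (\<Phi> t)) \<in> borel_measurable borel" "(\<lambda>t. B *v snd (\<Phi> t)) \<in> borel_measurable borel"
      using \<Phi> by (auto intro!: borel_measurable_continuous_onI continuous_intros)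
    thus "(\<lambda>t. (A *v fst (\<Phi> t) + f t (\<Phi> t), B *v snd (\<Phi> t) + g t (\<Phi> t))) \<in> borel_measurable borel"
      by (intro borel_measurable_Pair borel_measurable_add tame_measurable[OF f] tame_measurable[OF g] \<Phi>)
  next
    fix \<Phi> :: "real \<Rightarrow> (real^'n) \<times> (real^'m)" and t assume *: "isCont \<Phi> t" "t \<notin> D"
    have "isCont (\<lambda>t. A *v fst (\<Phi> t)) t" "isCont (\<lambda>t. B *v snd (\<Phi> t)) t"
      using * by (auto intro!: isCont_o2[OF _ matrix_vector_mult_linear_continuous_at] continuous_intros)
    moreover have "isCont (\<lambda>t. f t (\<Phi> t)) t" "isCont (\<lambda>t. g t (\<Phi> t)) t"
      using * f g by (auto simp: tame_def)
    ultimately show "isCont (\<lambda>t. (A *v fst (\<Phi> t) + f t (\<Phi> t), B *v snd (\<Phi> t) + g t (\<Phi> t))) t"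
      by (intro continuous_Pair continuous_add)
  next
    show "(A *v fst 0 + f t 0, B *v snd 0 + g t 0) = 0" for t
      using f g by (simp add: tame_def zero_prod_def)
  qed
  thus ?thesis by blast
qed

text \<open>A weight \<open>exp (- q * \<bar>t\<bar>)\<close> with \<open>q\<close> large turns the
  integral operator into a contraction on the whole line at once, so local solutions need not be
  continued. Integration gains \<open>L / q \<le> 1 / 4\<close>, and passing from the product norm
  to \<open>sum_norm\<close> costs a factor 2. The bound \<open>M\<close> is required only between 0
  and \<open>t\<close>, which makes one-sided uniqueness possible.\<close>

lemma primitive_exp_weight_le:
  assumes R: "tame D L R" and q: "q > 0" "4 * L \<le> q"
    and cont: "continuous_on UNIV \<Phi>" "continuous_on UNIV \<Psi>"
    and M: "\<And>s. s \<in> closed_segment 0 t \<Longrightarrow> exp (- q * \<bar>s\<bar>) * sum_norm (\<Phi> s - \<Psi> s) \<le> M"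
  shows "exp (- q * \<bar>t\<bar>) * sum_norm (primitive (\<lambda>s. R s (\<Phi> s)) t - primitive (\<lambda>s. R s (\<Psi> s)) t) \<le> 1 / 2 * M"
proof -
  have "0 \<le> exp (- q * \<bar>0\<bar>) * sum_norm (\<Phi> 0 - \<Psi> 0)" by simp
  also have "\<dots> \<le> M" using M[of 0] by simp
  finally have "M \<ge> 0" .
  \<comment> \<open>On the segment from 0 to \<open>t\<close> the absolute value is the linear
    function \<open>\<sigma> * s\<close>, which can be differentiated.\<close>
  define \<sigma> :: real where "\<sigma> = (if 0 \<le> t then 1 else -1)"
  have \<sigma>: "\<sigma> * s = \<bar>s\<bar>" if "s \<in> closed_segment 0 t" for s
    using that by (auto simp: \<sigma>_def closed_segment_eq_real_ivl split: if_splits)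
  have \<sigma>2: "\<sigma> * \<sigma> = 1" "\<bar>\<sigma>\<bar> = 1" by (auto simp: \<sigma>_def)
  note int = tame_loc_integrable[OF R cont(1)] tame_loc_integrable[OF R cont(2)]
  have "norm (primitive (\<lambda>s. R s (\<Phi> s) - R s (\<Psi> s)) t) \<le> \<bar>\<sigma> * M / 4 * exp (q * (\<sigma> * t)) - \<sigma> * M / 4 * exp (q * (\<sigma> * 0))\<bar>"
  proof (rule norm_primitive_le[where b="\<lambda>s. q / 4 * M * exp (q * (\<sigma> * s))"])
    show "loc_integrable (\<lambda>s. R s (\<Phi> s) - R s (\<Psi> s))"
      using int by (simp add: loc_integrable_def)
    show "((\<lambda>s. \<sigma> * M / 4 * exp (q * (\<sigma> * s))) has_real_derivative q / 4 * M * exp (q * (\<sigma> * s))) (at s)" for s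
      using \<sigma>2(1) by (auto intro!: derivative_eq_intros simp: algebra_simps)
    fix s assume s: "s \<in> closed_segment 0 t"
    have "norm (R s (\<Phi> s) - R s (\<Psi> s)) \<le> L * sum_norm (\<Phi> s - \<Psi> s)" by (rule tame_lipschitz[OF R])
    also have "sum_norm (\<Phi> s - \<Psi> s) \<le> M * exp (q * (\<sigma> * s))"
      using M[OF s] by (simp add: \<sigma>[OF s] exp_minus field_simps)
    also have "L * (M * exp (q * (\<sigma> * s))) \<le> q / 4 * (M * exp (q * (\<sigma> * s)))"
      using q \<open>M \<ge> 0\<close> by (intro mult_right_mono) auto
    finally show "norm (R s (\<Phi> s) - R s (\<Psi> s)) \<le> q / 4 * M * exp (q * (\<sigma> * s))"
      using tame_nonneg[OF R] by (simp add: mult_left_mono mult.assoc)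
  qed
  also have "\<dots> = \<bar>\<sigma> * (M / 4 * (exp (q * (\<sigma> * t)) - 1))\<bar>"
    by (simp add: algebra_simps)
  also have "\<dots> = M / 4 * (exp (q * \<bar>t\<bar>) - 1)"
    using \<open>M \<ge> 0\<close> q \<sigma>2 \<sigma>[of t] by (simp add: abs_mult)
  also have "\<dots> \<le> M / 4 * exp (q * \<bar>t\<bar>)"
    using \<open>M \<ge> 0\<close> by (simp add: algebra_simps)
  finally have "norm (primitive (\<lambda>s. R s (\<Phi> s) - R s (\<Psi> s)) t) \<le> M / 4 * exp (q * \<bar>t\<bar>)" .
  hence "sum_norm (primitive (\<lambda>s. R s (\<Phi> s)) t - primitive (\<lambda>s. R s (\<Psi> s)) t) \<le> M / 2 * exp (q * \<bar>t\<bar>)"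
    using sum_norm_le_2_norm[of "primitive (\<lambda>s. R s (\<Phi> s)) t - primitive (\<lambda>s. R s (\<Psi> s)) t"]
    by (simp add: primitive_diff[OF int])
  thus ?thesis by (simp add: exp_minus field_simps)
qed

lemma flow_exists:
  fixes R :: "real \<Rightarrow> 'a::euclidean_space \<times> 'b::euclidean_space \<Rightarrow> 'a \<times> 'b"
  assumes R: "tame D L R"
  shows "\<exists>S. continuous_on UNIV S \<and> (\<forall>t. S t = p + primitive (\<lambda>s. R s (S s)) t)"
proof -
  \<comment> \<open>The summand 1 keeps \<open>q\<close> positive when \<open>L = 0\<close>.\<close>
  define q where "q = 4 * L + 1"
  have q: "q > 0" "4 * L \<le> q" using tame_nonneg[OF R] by (auto simp: q_def)
  define w where "w t = exp (- q * \<bar>t\<bar>)" for t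
  define T where "T \<Phi> t = p + primitive (\<lambda>s. R s (\<Phi> s)) t" for \<Phi> t
  have contr: "w t * sum_norm (T \<Phi> t - T \<Psi> t) \<le> 1 / 2 * M"
    if "weighted_bounded UNIV w \<Phi>" "weighted_bounded UNIV w \<Psi>"
      and "\<And>t. w t * sum_norm (\<Phi> t - \<Psi> t) \<le> M" for \<Phi> \<Psi> M t
    using primitive_exp_weight_le[OF R q, of \<Phi> \<Psi> t M] that
    by (simp add: T_def w_def weighted_bounded_def)
  have "\<exists>S. weighted_bounded UNIV w S \<and> (\<forall>t\<in>UNIV. S t = T S t)"
  proof (rule weighted_fixed_point[where \<rho>="1/2"])
    fix \<Phi> :: "real \<Rightarrow> 'a \<times> 'b" assume \<Phi>: "weighted_bounded UNIV w \<Phi>"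
    then obtain C where C: "\<And>t. w t * sum_norm (\<Phi> t) \<le> C" by (auto simp: weighted_bounded_def)
    have "continuous_on UNIV (T \<Phi>)"
      unfolding T_def using \<Phi>
      by (intro continuous_intros continuous_primitive tame_loc_integrable[OF R]) (simp add: weighted_bounded_def)
    moreover have "w t * sum_norm (T \<Phi> t) \<le> 1 / 2 * C + sum_norm p" for t
    proof -
      \<comment> \<open>\<open>T\<close> sends the zero path to the constant path \<open>p\<close>,
        so the contraction estimate against the zero path bounds \<open>T \<Phi>\<close>.\<close>
      have "w t * sum_norm (T \<Phi> t - T (\<lambda>_. 0) t) \<le> 1 / 2 * C"
        by (rule contr[OF \<Phi>]) (auto simp: weighted_bounded_def C)
      moreover have "T (\<lambda>_. 0) t = p"
        using R by (simp add: T_def tame_def primitive_def)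
      moreover have "w t * sum_norm (T \<Phi> t) \<le> w t * (sum_norm (T \<Phi> t - p) + sum_norm p)"
        using sum_norm_triangle[of "T \<Phi> t - p" p] by (intro mult_left_mono) (auto simp: w_def)
      moreover have "w t * sum_norm p \<le> 1 * sum_norm p"
        using q by (intro mult_right_mono) (auto simp: w_def)
      ultimately show ?thesis by (simp add: distrib_left)
    qed
    ultimately show "weighted_bounded UNIV w (T \<Phi>)" unfolding weighted_bounded_def by blast
  qed (use contr in \<open>auto simp: w_def intro!: continuous_intros\<close>)
  thus ?thesis by (auto simp: weighted_bounded_def T_def)
qed

text \<open>Both paths need to solve the equation only between 0 and \<open>c\<close>. This matters
  because paths extended from the half line by a constant are known to solve it for nonpositive
  times only.\<close>

lemma flow_unique:
  assumes R: "tame D L R" and cont: "continuous_on UNIV S" "continuous_on UNIV S'"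
    and S: "\<And>t. t \<in> closed_segment 0 c \<Longrightarrow> S t = p + primitive (\<lambda>s. R s (S s)) t"
    and S': "\<And>t. t \<in> closed_segment 0 c \<Longrightarrow> S' t = p + primitive (\<lambda>s. R s (S' s)) t"
  shows "S c = S' c"
proof -
  define q where "q = 4 * L + 1"
  have q: "q > 0" "4 * L \<le> q" using tame_nonneg[OF R] by (auto simp: q_def)
  define h where "h t = exp (- q * \<bar>t\<bar>) * sum_norm (S t - S' t)" for t
  have "continuous_on (closed_segment 0 c) h"
    unfolding h_def by (intro continuous_intros continuous_on_subset[OF cont(1)] continuous_on_subset[OF cont(2)]) auto
  \<comment> \<open>The maximum over the compact segment is the a priori bound that the contraction
    then improves to 0.\<close>
  then obtain u where u: "\<And>t. t \<in> closed_segment 0 c \<Longrightarrow> h t \<le> h u"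
    using continuous_attains_sup[of "closed_segment 0 c" h] by auto
  have "h c \<le> 0 / (1 - 1/2)"
  proof (rule bound_by_contraction[where I="closed_segment 0 c" and h=h and d=0 and \<rho>="1/2" and t=c])
    fix M t assume M: "\<And>t. t \<in> closed_segment 0 c \<Longrightarrow> h t \<le> M" and t: "t \<in> closed_segment 0 c"
    have "closed_segment 0 t \<subseteq> closed_segment 0 c" using t by (simp add: subset_closed_segment)
    hence "exp (- q * \<bar>t\<bar>) * sum_norm (primitive (\<lambda>s. R s (S s)) t - primitive (\<lambda>s. R s (S' s)) t) \<le> 1 / 2 * M"
      using M by (intro primitive_exp_weight_le[OF R q cont]) (auto simp: h_def)
    moreover have "S t - S' t = primitive (\<lambda>s. R s (S s)) t - primitive (\<lambda>s. R s (S' s)) t"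
      using S[OF t] S'[OF t] by (metis add_diff_cancel_left)
    ultimately show "h t \<le> 0 + 1 / 2 * M" by (simp add: h_def)
  qed (use u in auto)
  hence "exp (- q * \<bar>c\<bar>) * sum_norm (S c - S' c) \<le> 0" by (simp add: h_def)
  hence "sum_norm (S c - S' c) \<le> 0" by (simp add: mult_le_0_iff)
  hence "sum_norm (S c - S' c) = 0" by (rule antisym) simp
  thus ?thesis by simp
qed

section \<open>The Lyapunov-Perron operator\<close>

lemma isCont_mat_exp_vec:
  assumes "isCont r t" "isCont y t"
  shows "isCont (\<lambda>s. mat_exp (r s *\<^sub>R M) *v y s) t"
proof (rule bounded_bilinear.continuous[OF bounded_bilinear_matrix_vector_mult _ assms(2)])
  have "isCont (\<lambda>t. mat_exp (t *\<^sub>R M)) (r t)"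
    using continuous_mat_exp[of M] by (simp add: continuous_on_eq_continuous_at)
  thus "isCont (\<lambda>s. mat_exp (r s *\<^sub>R M)) t" by (rule isCont_o2[OF assms(1)])
qed

lemma loc_integrable_mat_exp:
  assumes "continuous_on UNIV r" "loc_integrable y"
  shows "loc_integrable (\<lambda>s. mat_exp (r s *\<^sub>R M) *v y s)"
proof -
  obtain c where c: "\<And>M :: real^'a^'a. \<And>x. norm (M *v x) \<le> norm M * norm x * c" "c > 0"
    using bounded_bilinear.pos_bounded[OF bounded_bilinear_matrix_vector_mult] by blast
  show ?thesis
  proof (rule loc_integrable_bound[OF assms(2)])
    show "(\<lambda>s. mat_exp (r s *\<^sub>R M) *v y s) \<in> borel_measurable borel"
      by (intro borel_measurable_mat_exp_vec borel_measurable_continuous_onI assms loc_integrable_measurable)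
    show "continuous_on UNIV (\<lambda>s. c * norm (mat_exp (r s *\<^sub>R M)))"
      by (intro continuous_intros continuous_on_compose2[OF continuous_mat_exp assms(1)]) auto
  qed (use c(1) in \<open>simp add: mult_ac\<close>)
qed

lemma primitive_mat_exp:
  assumes "loc_integrable y"
  shows "primitive (\<lambda>s. mat_exp ((t - s) *\<^sub>R M) *v y s) t
    = mat_exp (t *\<^sub>R M) *v primitive (\<lambda>s. mat_exp (- s *\<^sub>R M) *v y s) t"
  unfolding mat_exp_diff_vec
  by (intro primitive_bounded_linear(2) matrix_vector_mul_bounded_linear
      loc_integrable_mat_exp assms continuous_intros)

section \<open>Variation of constants off a countable set\<close>

context
  fixes D :: "real set" and y :: "real \<Rightarrow> real^'n" and M :: "real^'n^'n"
  assumes D: "countable D" and y: "loc_integrable y" "\<And>t. t \<notin> D \<Longrightarrow> isCont y t"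
begin

lemma loc_integrable_mat_exp_minus: "loc_integrable (\<lambda>s. mat_exp (- s *\<^sub>R M) *v y s)"
  by (intro loc_integrable_mat_exp y continuous_intros)

lemma isCont_mat_exp_minus: "t \<notin> D \<Longrightarrow> isCont (\<lambda>s. mat_exp (- s *\<^sub>R M) *v y s) t"
  by (intro isCont_mat_exp_vec y continuous_intros)

lemma loc_integrable_linear_plus:
  assumes "continuous_on UNIV u"
  shows "loc_integrable (\<lambda>s. M *v u s + y s)"
proof (rule loc_integrable_add[OF _ y(1)])
  have *: "continuous_on UNIV (\<lambda>s. M *v u s)"
    by (intro continuous_intros assms)
  show "loc_integrable (\<lambda>s. M *v u s)"
    by (rule loc_integrable_continuous_bound[OF borel_measurable_continuous_onI[OF *], of "\<lambda>s. norm (M *v u s)"])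
      (intro continuous_intros *, simp)
qed

lemma isCont_linear_plus:
  assumes "continuous_on UNIV u" "t \<notin> D"
  shows "isCont (\<lambda>s. M *v u s + y s) t"
proof -
  have "continuous_on UNIV (\<lambda>s. M *v u s)" by (intro continuous_intros assms)
  thus ?thesis using y(2)[OF assms(2)] by (auto simp: continuous_on_eq_continuous_at intro!: continuous_add)
qed

lemma continuous_variation_of_constants:
  "continuous_on UNIV (\<lambda>t. mat_exp (t *\<^sub>R M) *v (u0 + primitive (\<lambda>s. mat_exp (- s *\<^sub>R M) *v y s) t))"
  by (intro continuous_intros continuous_primitive loc_integrable_mat_exp_minus)

text \<open>Off \<open>D\<close> the product rule gives the derivative
  \<open>M *v u t + y t\<close>, since the two exponentials in front of \<open>y t\<close> cancel;
  \<open>eq_primitive_if_deriv_off_countable\<close> integrates this.\<close>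

lemma variation_of_constants_solves:
  fixes u0 :: "real^'n"
  defines "u \<equiv> \<lambda>t. mat_exp (t *\<^sub>R M) *v (u0 + primitive (\<lambda>s. mat_exp (- s *\<^sub>R M) *v y s) t)"
  shows "u t = u0 + primitive (\<lambda>s. M *v u s + y s) t"
proof -
  have cont: "continuous_on UNIV u" unfolding u_def by (rule continuous_variation_of_constants)
  have "(u has_vector_derivative M *v u t + y t) (at t)" if "t \<notin> D" for t
  proof -
    have "((\<lambda>t. u0 + primitive (\<lambda>s. mat_exp (- s *\<^sub>R M) *v y s) t) has_vector_derivative
        mat_exp (- t *\<^sub>R M) *v y t) (at t)"
      using primitive_has_vector_derivative[OF loc_integrable_mat_exp_minus isCont_mat_exp_minus[OF that]]
      by (auto intro!: derivative_eq_intros)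
    from mat_exp_vec_has_vector_derivative[OF this, of M] show ?thesis
      by (simp add: u_def mat_exp_inverse_vec[of t M "y t", simplified])
  qed
  from eq_primitive_if_deriv_off_countable[OF D loc_integrable_linear_plus[OF cont] cont
      isCont_linear_plus[OF cont] this]
  have "u t = u 0 + primitive (\<lambda>s. M *v u s + y s) t" .
  thus ?thesis by (simp add: u_def)
qed

text \<open>The integrating factor removes the linear term, so
  \<open>mat_exp (- t *\<^sub>R M) *v u t\<close> is \<open>u0\<close> plus a primitive.\<close>

lemma variation_of_constants_unique:
  assumes cont: "continuous_on UNIV u" and u: "\<And>t. u t = u0 + primitive (\<lambda>s. M *v u s + y s) t"
  shows "u t = mat_exp (t *\<^sub>R M) *v (u0 + primitive (\<lambda>s. mat_exp (- s *\<^sub>R M) *v y s) t)"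
proof -
  have "(u has_vector_derivative M *v u t + y t) (at t)" if "t \<notin> D" for t
  proof -
    have "((\<lambda>t. u0 + primitive (\<lambda>s. M *v u s + y s) t) has_vector_derivative M *v u t + y t) (at t)"
      using primitive_has_vector_derivative[OF loc_integrable_linear_plus[OF cont] isCont_linear_plus[OF cont that]]
      by (auto intro!: derivative_eq_intros)
    thus ?thesis by (simp flip: u)
  qed
  hence d: "((\<lambda>t. mat_exp (- t *\<^sub>R M) *v u t) has_vector_derivative mat_exp (- t *\<^sub>R M) *v y t) (at t)"
    if "t \<notin> D" for t
    using mat_exp_neg_vec_has_vector_derivative[of u "M *v u t + y t" t M] that by simp
  have "mat_exp (- t *\<^sub>R M) *v u t = mat_exp (- 0 *\<^sub>R M) *v u 0 + primitive (\<lambda>s. mat_exp (- s *\<^sub>R M) *v y s) t"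
    by (rule eq_primitive_if_deriv_off_countable[OF D loc_integrable_mat_exp_minus _ isCont_mat_exp_minus d])
      (intro continuous_intros cont)
  moreover have "u 0 = u0" using u[of 0] by simp
  ultimately have "mat_exp (- t *\<^sub>R M) *v u t = u0 + primitive (\<lambda>s. mat_exp (- s *\<^sub>R M) *v y s) t" by simp
  thus ?thesis by (metis mat_exp_inverse_vec)
qed

end

lemma primitive_Pair:
  assumes "loc_integrable u" "loc_integrable v"
  shows "loc_integrable (\<lambda>s. (u s, v s))" "primitive (\<lambda>s. (u s, v s)) t = (primitive u t, primitive v t)"
proof -
  have *: "loc_integrable (\<lambda>s. (u s, 0 :: 'b) + (0 :: 'a, v s))"
    by (intro loc_integrable_add primitive_bounded_linear(1)[OF assms(1)] primitive_bounded_linear(1)[OF assms(2)]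
        bounded_linear_Pair bounded_linear_zero bounded_linear_ident)
  thus l: "loc_integrable (\<lambda>s. (u s, v s))" by simp
  show "primitive (\<lambda>s. (u s, v s)) t = (primitive u t, primitive v t)"
    using primitive_bounded_linear(2)[OF l bounded_linear_fst, of t]
      primitive_bounded_linear(2)[OF l bounded_linear_snd, of t] by (simp add: prod_eq_iff)
qed

lemma set_integral_exp_atMost:
  fixes c :: real
  assumes "c > 0"
  shows "set_integrable lborel {..t} (\<lambda>s. exp (c * s))" "(LINT s:{..t}|lborel. exp (c * s)) = exp (c * t) / c"
proof -
  have ein: "einterval (-\<infinity>) (ereal t) = {..<t}" by (auto simp: einterval_iff)
  have d: "DERIV (\<lambda>s. exp (c * s) / c) s :> exp (c * s)" for s
    using assms by (auto intro!: derivative_eq_intros)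
  have bot: "((\<lambda>s. exp (c * s) / c) \<longlongrightarrow> 0) at_bot"
    using assms by (auto intro!: tendsto_divide_zero filterlim_compose[OF exp_at_bot]
        filterlim_tendsto_pos_mult_at_bot[OF tendsto_const] filterlim_ident)
  have left: "((\<lambda>s. exp (c * s) / c) \<longlongrightarrow> exp (c * t) / c) (at_left t)"
    by (intro tendsto_intros) (use assms in auto)
  have "set_integrable lborel (einterval (-\<infinity>) (ereal t)) (\<lambda>s. exp (c * s))"
    "(LBINT s=-\<infinity>..ereal t. exp (c * s)) = exp (c * t) / c - 0"
    by (rule interval_integral_FTC_nonneg[where F="\<lambda>s. exp (c * s) / c"];
        use d bot left in \<open>auto simp: ereal_tendsto_simps intro!: continuous_intros\<close>)+
  moreover have "set_integrable lborel {..<t} (\<lambda>s. exp (c * s)) \<longleftrightarrow> set_integrable lborel {..t} (\<lambda>s. exp (c * s))"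
    "(LINT s:{..<t}|lborel. exp (c * s)) = (LINT s:{..t}|lborel. exp (c * s))"
    by (rule set_integrable_discrete_difference[where X="{t}"] set_integral_discrete_difference[where X="{t}"]; auto)+
  ultimately show "set_integrable lborel {..t} (\<lambda>s. exp (c * s))" "(LINT s:{..t}|lborel. exp (c * s)) = exp (c * t) / c"
    by (simp_all add: ein interval_lebesgue_integral_def)
qed

text \<open>The deterministic core: \<open>f\<close> and \<open>g\<close> stand for the increments
  along the base orbit in the transformed coordinates, so that the zero path represents the base
  orbit itself.\<close>

locale dichotomy =
  fixes A :: "real^'n^'n" and B :: "real^'m^'m" and a b \<eta> K :: real and D :: "real set"
    and f :: "real \<Rightarrow> (real^'n) \<times> (real^'m) \<Rightarrow> real^'n"
    and g :: "real \<Rightarrow> (real^'n) \<times> (real^'m) \<Rightarrow> real^'m"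
  assumes expA: "\<And>t x. t \<le> 0 \<Longrightarrow> norm (mat_exp (t *\<^sub>R A) *v x) \<le> exp (a * t) * norm x"
    and expB: "\<And>t y. t \<ge> 0 \<Longrightarrow> norm (mat_exp (t *\<^sub>R B) *v y) \<le> exp (b * t) * norm y"
    and \<eta>: "b < \<eta>" "\<eta> < a"
    and gap: "K * (1 / (\<eta> - b) + 1 / (a - \<eta>)) < 1"
    and D: "countable D" and f: "tame D K f" and g: "tame D K g"
begin

text \<open>The integral term of the unstable component. For \<open>t \<le> s\<close> and
  \<open>s \<le> 0\<close> the exponential runs backward in time, where \<open>expA\<close>
  applies.\<close>

definition forward :: "(real \<Rightarrow> real^'n) \<Rightarrow> real \<Rightarrow> real^'n" where
  "forward y t = primitive (\<lambda>s. mat_exp ((t - s) *\<^sub>R A) *v y s) t"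

text \<open>The integral term of the stable component. Integrating from minus infinity leaves no
  boundary term, so the initial value of this component is \<open>backward y 0\<close> and cannot be
  prescribed.\<close>

definition backward :: "(real \<Rightarrow> real^'m) \<Rightarrow> real \<Rightarrow> real^'m" where
  "backward y t = (LINT s:{..t}|lborel. mat_exp ((t - s) *\<^sub>R B) *v y s)"

definition lp_map :: "real^'n \<Rightarrow> (real \<Rightarrow> (real^'n) \<times> (real^'m)) \<Rightarrow> real \<Rightarrow> (real^'n) \<times> (real^'m)" where
  "lp_map x \<Phi> t = (mat_exp (t *\<^sub>R A) *v x + forward (\<lambda>s. f s (\<Phi> s)) t, backward (\<lambda>s. g s (\<Phi> s)) t)"

definition weight :: "real \<Rightarrow> real" where "weight t = exp (- \<eta> * t)"

definition lp_solution :: "real^'n \<Rightarrow> (real \<Rightarrow> (real^'n) \<times> (real^'m)) \<Rightarrow> bool" where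
  "lp_solution x \<Phi> \<longleftrightarrow> weighted_bounded {..0} weight \<Phi> \<and> (\<forall>t\<le>0. \<Phi> t = lp_map x \<Phi> t)"

definition rate :: real where "rate = K * (1 / (\<eta> - b) + 1 / (a - \<eta>))"

definition field :: "real \<Rightarrow> (real^'n) \<times> (real^'m) \<Rightarrow> (real^'n) \<times> (real^'m)" where
  "field t p = (A *v fst p + f t p, B *v snd p + g t p)"

lemma K_nonneg: "0 \<le> K" using f by (rule tame_nonneg)

lemma rate: "0 \<le> rate" "rate < 1"
  using K_nonneg \<eta> gap by (auto simp: rate_def)

text \<open>The integrand is dominated by \<open>C * exp (b * (t - s)) * exp (\<eta> * s)\<close>,
  integrable at minus infinity because \<open>b < \<eta>\<close>; its integral up to
  \<open>t\<close> is the source of \<open>1 / (\<eta> - b)\<close>.\<close>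

lemma backward_integrable_and_bound:
  assumes y: "y \<in> borel_measurable borel" and bound: "\<And>s. s \<le> t \<Longrightarrow> norm (y s) \<le> C * exp (\<eta> * s)"
  shows "set_integrable lborel {..t} (\<lambda>s. mat_exp ((t - s) *\<^sub>R B) *v y s)"
    and "norm (backward y t) \<le> C / (\<eta> - b) * exp (\<eta> * t)"
proof -
  let ?k = "\<lambda>s. mat_exp ((t - s) *\<^sub>R B) *v y s"
  let ?e = "\<lambda>s. (C * exp (b * t)) * exp ((\<eta> - b) * s)"
  have e: "set_integrable lborel {..t} ?e"
    using set_integral_exp_atMost(1)[of "\<eta> - b" t] \<eta> by (intro set_integrable_mult_right) auto
  have le: "norm (?k s) \<le> ?e s" if "s \<le> t" for s
  proof -
    have "norm (?k s) \<le> exp (b * (t - s)) * norm (y s)" using that by (intro expB) simp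
    also have "\<dots> \<le> exp (b * (t - s)) * (C * exp (\<eta> * s))" by (intro mult_left_mono bound that) simp
    also have "\<dots> = ?e s" by (simp add: algebra_simps flip: exp_add)
    finally show ?thesis .
  qed
  have k: "?k \<in> borel_measurable borel"
    by (intro borel_measurable_mat_exp_vec y) simp
  show int: "set_integrable lborel {..t} ?k"
    unfolding set_integrable_def
  proof (rule Bochner_Integration.integrable_bound)
    show "integrable lborel (\<lambda>s. indicat_real {..t} s *\<^sub>R ?e s)" using e by (simp add: set_integrable_def)
    show "(\<lambda>s. indicat_real {..t} s *\<^sub>R ?k s) \<in> borel_measurable lborel" using k by simp
    show "AE s in lborel. norm (indicat_real {..t} s *\<^sub>R ?k s) \<le> norm (indicat_real {..t} s *\<^sub>R ?e s)"
      using le by (auto simp: indicator_def intro: order_trans[OF _ abs_ge_self])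
  qed
  have "norm (backward y t) \<le> (LINT s:{..t}|lborel. norm (?k s))"
    unfolding backward_def by (rule set_integral_norm_bound[OF int])
  also have "\<dots> \<le> (LINT s:{..t}|lborel. ?e s)"
    using le by (intro set_integral_mono set_integrable_norm int e) auto
  also have "\<dots> = C * exp (b * t) * (exp ((\<eta> - b) * t) / (\<eta> - b))"
    using set_integral_exp_atMost(2)[of "\<eta> - b" t] \<eta> by (simp add: set_integral_mult_right)
  also have "\<dots> = C / (\<eta> - b) * exp (\<eta> * t)"
    by (simp add: algebra_simps flip: exp_add)
  finally show "norm (backward y t) \<le> C / (\<eta> - b) * exp (\<eta> * t)" .
qed

text \<open>The majorant \<open>C * exp (a * (t - s)) * exp (\<eta> * s)\<close> has integral
  \<open>C / (a - \<eta>) * (exp (\<eta> * t) - exp (a * t))\<close> over \<open>{t..0}\<close>.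
  Dropping the second exponential leaves the fraction \<open>1 / (a - \<eta>)\<close>.\<close>

lemma forward_bound:
  assumes y: "loc_integrable y" and "t \<le> 0" and bound: "\<And>s. s \<le> 0 \<Longrightarrow> norm (y s) \<le> C * exp (\<eta> * s)"
  shows "norm (forward y t) \<le> C / (a - \<eta>) * exp (\<eta> * t)"
proof -
  have "0 \<le> norm (y 0)" by simp
  also have "\<dots> \<le> C" using bound[of 0] by simp
  finally have C: "C \<ge> 0" .
  \<comment> \<open>An antiderivative in \<open>s\<close> of the majorant.\<close>
  let ?\<beta> = "\<lambda>s. - C / (a - \<eta>) * exp (a * t - (a - \<eta>) * s)"
  have "norm (forward y t) \<le> \<bar>?\<beta> t - ?\<beta> 0\<bar>"
    unfolding forward_def
  proof (rule norm_primitive_le[where b="\<lambda>s. C * exp (a * t - (a - \<eta>) * s)"])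
    show "(?\<beta> has_real_derivative C * exp (a * t - (a - \<eta>) * s)) (at s)" for s
    proof -
      have "(?\<beta> has_real_derivative - C / (a - \<eta>) * (exp (a * t - (a - \<eta>) * s) * - (a - \<eta>))) (at s)"
        by (rule DERIV_cmult) (auto intro!: derivative_eq_intros)
      moreover have "- C / d * (e * - d) = C * e" if "d \<noteq> 0" for d e
        using that by simp
      moreover have "a - \<eta> \<noteq> 0" using \<eta> by simp
      ultimately show ?thesis by metis
    qed
    show "loc_integrable (\<lambda>s. mat_exp ((t - s) *\<^sub>R A) *v y s)"
      by (intro loc_integrable_mat_exp y continuous_intros)
    fix s assume "s \<in> closed_segment 0 t"
    hence s: "t \<le> s" "s \<le> 0" using \<open>t \<le> 0\<close> by (auto simp: closed_segment_eq_real_ivl split: if_splits)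
    have "norm (mat_exp ((t - s) *\<^sub>R A) *v y s) \<le> exp (a * (t - s)) * norm (y s)" using s by (intro expA) simp
    also have "\<dots> \<le> exp (a * (t - s)) * (C * exp (\<eta> * s))" by (intro mult_left_mono bound s) simp
    also have "\<dots> = C * exp (a * t - (a - \<eta>) * s)" by (simp add: algebra_simps flip: exp_add)
    finally show "norm (mat_exp ((t - s) *\<^sub>R A) *v y s) \<le> C * exp (a * t - (a - \<eta>) * s)" .
  qed
  also have "?\<beta> t - ?\<beta> 0 = - (C / (a - \<eta>) * (exp (\<eta> * t) - exp (a * t)))"
    by (simp add: algebra_simps)
  also have "\<bar>\<dots>\<bar> = C / (a - \<eta>) * (exp (\<eta> * t) - exp (a * t))"
  proof -
    have "a * t \<le> \<eta> * t" using \<open>t \<le> 0\<close> \<eta> by (simp add: mult_right_mono_neg)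
    thus ?thesis using C \<eta> by simp
  qed
  also have "\<dots> \<le> C / (a - \<eta>) * exp (\<eta> * t)"
    using C \<eta> by (intro mult_left_mono) auto
  finally show ?thesis .
qed

lemma lp_map_cong:
  assumes "\<And>s. s \<le> 0 \<Longrightarrow> \<Phi> s = \<Psi> s" "t \<le> 0"
  shows "lp_map x \<Phi> t = lp_map x \<Psi> t"
  unfolding lp_map_def forward_def backward_def using assms
  by (auto intro!: primitive_cong(1) set_lebesgue_integral_cong simp: closed_segment_eq_real_ivl split: if_splits)

text \<open>Paths of the weighted space live on the half line, whereas \<open>tame\<close> and
  \<open>loc_integrable\<close> speak of the whole line. Freezing the value at 0 for positive times
  bridges the gap, and by \<open>lp_map_cong\<close> the operator does not notice it for
  \<open>t \<le> 0\<close>.\<close>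

lemma continuous_clip:
  fixes \<Phi> :: "real \<Rightarrow> 'z::topological_space"
  assumes "continuous_on {..0} \<Phi>"
  shows "continuous_on UNIV (\<lambda>t. \<Phi> (min t 0))"
  by (rule continuous_on_compose2[OF assms]) (auto intro!: continuous_intros)

lemma weighted_norm_le:
  assumes "tame D K h" "weight s * sum_norm (\<Phi> s - \<Psi> s) \<le> M"
  shows "norm (h s (\<Phi> s) - h s (\<Psi> s)) \<le> (K * M) * exp (\<eta> * s)"
proof -
  have "sum_norm (\<Phi> s - \<Psi> s) \<le> M * exp (\<eta> * s)"
    using assms(2) by (simp add: weight_def exp_minus field_simps)
  from mult_left_mono[OF this K_nonneg] tame_lipschitz[OF assms(1), of s "\<Phi> s" "\<Psi> s"]
  show ?thesis by (simp add: mult.assoc)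
qed

lemma backward_integrable:
  assumes \<Phi>: "continuous_on UNIV \<Phi>" "weighted_bounded {..0} weight \<Phi>" and t: "t \<le> 0"
  shows "set_integrable lborel {..t} (\<lambda>s. mat_exp ((t - s) *\<^sub>R B) *v g s (\<Phi> s))"
    and "\<exists>C. \<forall>t\<le>0. norm (backward (\<lambda>s. g s (\<Phi> s)) t) \<le> C * exp (\<eta> * t)"
proof -
  obtain C where C: "\<And>s. s \<le> 0 \<Longrightarrow> weight s * sum_norm (\<Phi> s) \<le> C" using \<Phi>(2) by (auto simp: weighted_bounded_def)
  have "norm (g s (\<Phi> s)) \<le> (K * C) * exp (\<eta> * s)" if "s \<le> 0" for s
    using weighted_norm_le[OF g, of s \<Phi> "\<lambda>_. 0" C] C[OF that] g by (simp add: tame_def)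
  note * = backward_integrable_and_bound[OF tame_measurable[OF g \<Phi>(1)] this]
  show "set_integrable lborel {..t} (\<lambda>s. mat_exp ((t - s) *\<^sub>R B) *v g s (\<Phi> s))"
    using * t by auto
  show "\<exists>C. \<forall>t\<le>0. norm (backward (\<lambda>s. g s (\<Phi> s)) t) \<le> C * exp (\<eta> * t)"
    using *(2) by (intro exI[of _ "K * C / (\<eta> - b)"]) auto
qed

text \<open>Cutting the integral over \<open>{..0}\<close> at \<open>t\<close> brings the backward
  integral into variation of constants form with initial value \<open>backward y 0\<close>, which
  makes it comparable with an orbit.\<close>

lemma backward_split:
  assumes \<Phi>: "continuous_on UNIV \<Phi>" "weighted_bounded {..0} weight \<Phi>" and t: "t \<le> 0"
  defines "y \<equiv> \<lambda>s. g s (\<Phi> s)"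
  shows "backward y t = mat_exp (t *\<^sub>R B) *v (backward y 0 + primitive (\<lambda>s. mat_exp (- s *\<^sub>R B) *v y s) t)"
proof -
  let ?k = "\<lambda>s. mat_exp (- s *\<^sub>R B) *v y s"
  have k0: "set_integrable lborel {..0} ?k"
    using backward_integrable(1)[OF \<Phi>, of 0] by (simp add: y_def)
  have kt: "set_integrable lborel {..t} ?k" "set_integrable lborel {t<..0} ?k"
    by (rule set_integrable_subset[OF k0]; use t in auto)+
  have "backward y t = (LINT s:{..t}|lborel. mat_exp (t *\<^sub>R B) *v ?k s)"
    by (simp only: backward_def mat_exp_diff_vec)
  also have "\<dots> = mat_exp (t *\<^sub>R B) *v (LINT s:{..t}|lborel. ?k s)"
    using integral_bounded_linear[OF matrix_vector_mul_bounded_linear kt(1)[unfolded set_integrable_def], of "mat_exp (t *\<^sub>R B)"]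
    by (simp add: set_lebesgue_integral_def matrix_vector_mult_scaleR)
  also have "(LINT s:{..t}|lborel. ?k s) = (LINT s:{..0}|lborel. ?k s) - (LINT s:{t<..0}|lborel. ?k s)"
  proof -
    have "{..0} = {..t} \<union> {t<..0}" using t by auto
    thus ?thesis using set_integral_Un[OF _ kt] by (simp add: ivl_disj_int)
  qed
  \<comment> \<open>The primitive is oriented from 0 down to \<open>t\<close>, hence the minus
    sign.\<close>
  also have "(LINT s:{t<..0}|lborel. ?k s) = - primitive ?k t"
    unfolding primitive_def interval_integral_endpoints_reverse[of "ereal 0"]
    using interval_integral_Ioc[OF t, of ?k] by simp
  also have "(LINT s:{..0}|lborel. ?k s) = backward y 0"
    by (simp add: backward_def)
  finally show ?thesis by simp
qed

text \<open>Distinct \<open>x\<close> and \<open>x'\<close> are allowed, so that one estimate yields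
  both the contraction and the Lipschitz dependence on the initial value. The stable component is
  recorded separately because the Lipschitz constant of \<open>lmap\<close> sees only its share
  \<open>K / (\<eta> - b)\<close>.\<close>

lemma lp_map_contraction:
  assumes \<Phi>: "weighted_bounded {..0} weight \<Phi>" and \<Psi>: "weighted_bounded {..0} weight \<Psi>"
    and M: "\<And>s. s \<le> 0 \<Longrightarrow> weight s * sum_norm (\<Phi> s - \<Psi> s) \<le> M" and t: "t \<le> 0"
  shows "norm (backward (\<lambda>s. g s (\<Phi> s)) t - backward (\<lambda>s. g s (\<Psi> s)) t) \<le> K * M / (\<eta> - b) * exp (\<eta> * t)"
    and "weight t * sum_norm (lp_map x \<Phi> t - lp_map x' \<Psi> t) \<le> norm (x - x') + rate * M"
proof -
  define P Q where "P s = \<Phi> (min s 0)" and "Q s = \<Psi> (min s 0)" for s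
  have eq: "P s = \<Phi> s" "Q s = \<Psi> s" if "s \<le> 0" for s using that by (auto simp: P_def Q_def)
  have cont: "continuous_on UNIV P" "continuous_on UNIV Q"
    unfolding P_def Q_def using \<Phi> \<Psi> by (auto intro!: continuous_clip simp: weighted_bounded_def)
  have wb: "weighted_bounded {..0} weight P" "weighted_bounded {..0} weight Q"
    using \<Phi> \<Psi> unfolding weighted_bounded_def
    by (auto simp: eq intro: continuous_on_subset[OF cont(1)] continuous_on_subset[OF cont(2)])
  have M': "weight s * sum_norm (P s - Q s) \<le> M" if "s \<le> 0" for s using M[OF that] eq[OF that] by simp
  have B: "norm (backward (\<lambda>s. g s (P s)) t - backward (\<lambda>s. g s (Q s)) t) \<le> K * M / (\<eta> - b) * exp (\<eta> * t)"
  proof -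
    have "backward (\<lambda>s. g s (P s)) t - backward (\<lambda>s. g s (Q s)) t = backward (\<lambda>s. g s (P s) - g s (Q s)) t"
      unfolding backward_def matrix_vector_mult_diff_distrib
      by (rule set_integral_diff(2)[OF backward_integrable(1)[OF cont(1) wb(1) t]
            backward_integrable(1)[OF cont(2) wb(2) t], symmetric])
    moreover have "norm (backward (\<lambda>s. g s (P s) - g s (Q s)) t) \<le> K * M / (\<eta> - b) * exp (\<eta> * t)"
      using t by (intro backward_integrable_and_bound borel_measurable_diff tame_measurable[OF g] cont
          weighted_norm_le[OF g] M') auto
    ultimately show ?thesis by simp
  qed
  have eqb: "backward (\<lambda>s. g s (P s)) t = backward (\<lambda>s. g s (\<Phi> s)) t"
    "backward (\<lambda>s. g s (Q s)) t = backward (\<lambda>s. g s (\<Psi> s)) t"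
    unfolding backward_def using t by (auto intro!: set_lebesgue_integral_cong simp: eq)
  show "norm (backward (\<lambda>s. g s (\<Phi> s)) t - backward (\<lambda>s. g s (\<Psi> s)) t) \<le> K * M / (\<eta> - b) * exp (\<eta> * t)"
    using B by (simp add: eqb)
  have F: "norm (forward (\<lambda>s. f s (P s)) t - forward (\<lambda>s. f s (Q s)) t) \<le> K * M / (a - \<eta>) * exp (\<eta> * t)"
  proof -
    note int = tame_loc_integrable[OF f cont(1)] tame_loc_integrable[OF f cont(2)]
    have "forward (\<lambda>s. f s (P s)) t - forward (\<lambda>s. f s (Q s)) t = forward (\<lambda>s. f s (P s) - f s (Q s)) t"
      unfolding forward_def matrix_vector_mult_diff_distrib
      by (rule primitive_diff[symmetric]; intro loc_integrable_mat_exp int continuous_intros)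
    moreover have "loc_integrable (\<lambda>s. f s (P s) - f s (Q s))"
      using int by (simp add: loc_integrable_def)
    hence "norm (forward (\<lambda>s. f s (P s) - f s (Q s)) t) \<le> K * M / (a - \<eta>) * exp (\<eta> * t)"
      using t by (intro forward_bound weighted_norm_le[OF f] M') auto
    ultimately show ?thesis by simp
  qed
  have X: "norm (mat_exp (t *\<^sub>R A) *v x - mat_exp (t *\<^sub>R A) *v x') \<le> norm (x - x') * exp (\<eta> * t)"
  proof -
    have "norm (mat_exp (t *\<^sub>R A) *v (x - x')) \<le> exp (a * t) * norm (x - x')" by (rule expA[OF t])
    also have "\<dots> \<le> exp (\<eta> * t) * norm (x - x')"
      using t \<eta> by (intro mult_right_mono) (auto simp: mult_right_mono_neg)
    finally show ?thesis by (simp add: matrix_vector_mult_diff_distrib mult.commute)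
  qed
  have "sum_norm (lp_map x P t - lp_map x' Q t)
      \<le> norm (mat_exp (t *\<^sub>R A) *v x - mat_exp (t *\<^sub>R A) *v x')
        + norm (forward (\<lambda>s. f s (P s)) t - forward (\<lambda>s. f s (Q s)) t)
        + norm (backward (\<lambda>s. g s (P s)) t - backward (\<lambda>s. g s (Q s)) t)"
    unfolding sum_norm_def lp_map_def by (simp add: norm_diff_triangle_ineq)
  also have "\<dots> \<le> (norm (x - x') + rate * M) * exp (\<eta> * t)"
    using X F B by (simp add: rate_def algebra_simps add_divide_distrib)
  finally have "sum_norm (lp_map x P t - lp_map x' Q t) \<le> (norm (x - x') + rate * M) * exp (\<eta> * t)" .
  hence "weight t * sum_norm (lp_map x P t - lp_map x' Q t) \<le> norm (x - x') + rate * M"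
    by (simp add: weight_def exp_minus field_simps)
  thus "weight t * sum_norm (lp_map x \<Phi> t - lp_map x' \<Psi> t) \<le> norm (x - x') + rate * M"
    using lp_map_cong[of P \<Phi> t x] lp_map_cong[of Q \<Psi> t x'] eq t by simp
qed

lemma field_integrable:
  assumes "continuous_on UNIV P"
  shows "loc_integrable (\<lambda>s. A *v fst (P s) + f s (P s))" "loc_integrable (\<lambda>s. B *v snd (P s) + g s (P s))"
  using assms
  by (auto intro!: loc_integrable_linear_plus[OF D] tame_loc_integrable[OF f] tame_loc_integrable[OF g]
      tame_isCont[OF f] tame_isCont[OF g] continuous_intros)

text \<open>In this form continuity of the image and the differential equations behind the operator
  become visible; the initial value is \<open>x\<close> paired with the backward integral at
  0.\<close>

lemma lp_map_variation:
  assumes \<Phi>: "continuous_on UNIV \<Phi>" "weighted_bounded {..0} weight \<Phi>" and t: "t \<le> 0"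
  shows "lp_map x \<Phi> t =
    (mat_exp (t *\<^sub>R A) *v (x + primitive (\<lambda>s. mat_exp (- s *\<^sub>R A) *v f s (\<Phi> s)) t),
     mat_exp (t *\<^sub>R B) *v (backward (\<lambda>s. g s (\<Phi> s)) 0 + primitive (\<lambda>s. mat_exp (- s *\<^sub>R B) *v g s (\<Phi> s)) t))"
  unfolding lp_map_def forward_def primitive_mat_exp[OF tame_loc_integrable[OF f \<Phi>(1)]]
    backward_split[OF \<Phi> t]
  by (simp add: matrix_vector_right_distrib)

lemma continuous_lp_map:
  assumes \<Phi>: "continuous_on UNIV \<Phi>" "weighted_bounded {..0} weight \<Phi>"
  shows "continuous_on {..0} (lp_map x \<Phi>)"
proof -
  have "continuous_on UNIV (\<lambda>t. (mat_exp (t *\<^sub>R A) *v (x + primitive (\<lambda>s. mat_exp (- s *\<^sub>R A) *v f s (\<Phi> s)) t),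
     mat_exp (t *\<^sub>R B) *v (backward (\<lambda>s. g s (\<Phi> s)) 0 + primitive (\<lambda>s. mat_exp (- s *\<^sub>R B) *v g s (\<Phi> s)) t)))"
    using \<Phi>(1)
    by (intro continuous_on_Pair continuous_variation_of_constants[OF D] tame_loc_integrable[OF f]
        tame_loc_integrable[OF g] tame_isCont[OF f] tame_isCont[OF g])
  hence "continuous_on {..0} (\<lambda>t. (mat_exp (t *\<^sub>R A) *v (x + primitive (\<lambda>s. mat_exp (- s *\<^sub>R A) *v f s (\<Phi> s)) t),
     mat_exp (t *\<^sub>R B) *v (backward (\<lambda>s. g s (\<Phi> s)) 0 + primitive (\<lambda>s. mat_exp (- s *\<^sub>R B) *v g s (\<Phi> s)) t)))"
    by (rule continuous_on_subset) simp
  thus ?thesis by (rule continuous_on_eq) (simp add: lp_map_variation[OF \<Phi>])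
qed

lemma weighted_bounded_clip:
  assumes "weighted_bounded {..0} weight \<Phi>"
  shows "weighted_bounded {..0} weight (\<lambda>t. \<Phi> (min t 0))" "continuous_on UNIV (\<lambda>t. \<Phi> (min t 0))"
proof -
  show *: "continuous_on UNIV (\<lambda>t. \<Phi> (min t 0))"
    using assms by (intro continuous_clip) (simp add: weighted_bounded_def)
  show "weighted_bounded {..0} weight (\<lambda>t. \<Phi> (min t 0))"
    using assms continuous_on_subset[OF *] by (auto simp: weighted_bounded_def min_def)
qed

lemma lp_solution_exists: "\<exists>\<Phi>. lp_solution x \<Phi>"
proof -
  have "\<exists>\<Phi>. weighted_bounded {..0} weight \<Phi> \<and> (\<forall>t\<in>{..0}. \<Phi> t = lp_map x \<Phi> t)"
  proof (rule weighted_fixed_point[where \<rho>=rate])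
    fix \<Phi> :: "real \<Rightarrow> (real^'n) \<times> (real^'m)" assume \<Phi>: "weighted_bounded {..0} weight \<Phi>"
    then obtain C where C: "\<And>t. t \<le> 0 \<Longrightarrow> weight t * sum_norm (\<Phi> t) \<le> C" by (auto simp: weighted_bounded_def)
    have zero: "weighted_bounded {..0} weight (\<lambda>_. 0 :: (real^'n) \<times> (real^'m))"
      by (auto simp: weighted_bounded_def)
    have lp0: "lp_map 0 (\<lambda>_. 0) t = 0" for t
    proof -
      have "primitive (\<lambda>s. mat_exp ((t - s) *\<^sub>R A) *v f s 0) t = 0"
        using f by (simp add: tame_def primitive_def)
      moreover have "(LINT s:{..t}|lborel. mat_exp ((t - s) *\<^sub>R B) *v g s 0) = 0"
        using g by (simp add: tame_def set_lebesgue_integral_def)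
      ultimately show ?thesis by (simp add: lp_map_def forward_def backward_def zero_prod_def)
    qed
    \<comment> \<open>The zero path is fixed for initial value 0, so comparison with it shows that
      the operator maps the weighted space into itself.\<close>
    have "weight t * sum_norm (lp_map x \<Phi> t) \<le> norm x + rate * C" if "t \<le> 0" for t
      using lp_map_contraction(2)[OF \<Phi> zero _ that, of C x 0] C lp0 by simp
    moreover have "continuous_on {..0} (lp_map x \<Phi>)"
    proof (rule continuous_on_eq)
      show "continuous_on {..0} (lp_map x (\<lambda>t. \<Phi> (min t 0)))"
        by (rule continuous_lp_map[OF weighted_bounded_clip(2,1)[OF \<Phi>]])
    qed (auto intro!: lp_map_cong)
    ultimately show "weighted_bounded {..0} weight (lp_map x \<Phi>)" by (auto simp: weighted_bounded_def)
  next
    fix \<Phi> \<Psi> :: "real \<Rightarrow> (real^'n) \<times> (real^'m)" and M t :: real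
    assume "weighted_bounded {..0} weight \<Phi>" "weighted_bounded {..0} weight \<Psi>"
      "\<And>t. t \<in> {..0} \<Longrightarrow> weight t * sum_norm (\<Phi> t - \<Psi> t) \<le> M" "t \<in> {..0}"
    thus "weight t * sum_norm (lp_map x \<Phi> t - lp_map x \<Psi> t) \<le> rate * M"
      using lp_map_contraction(2)[of \<Phi> \<Psi> M t x x] by simp
  qed (use rate in \<open>auto simp: weight_def intro!: continuous_intros\<close>)
  thus ?thesis by (auto simp: lp_solution_def)
qed

text \<open>Both paths are fixed points, so any bound \<open>M\<close> of their weighted distance
  improves to \<open>norm (x - x') + rate * M\<close>; iterating gives the factor
  \<open>1 / (1 - rate)\<close>.\<close>

lemma lp_solution_lipschitz:
  assumes \<Phi>: "lp_solution x \<Phi>" and \<Psi>: "lp_solution x' \<Psi>" and t: "t \<le> 0"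
  shows "weight t * sum_norm (\<Phi> t - \<Psi> t) \<le> norm (x - x') / (1 - rate)"
proof -
  have wb: "weighted_bounded {..0} weight \<Phi>" "weighted_bounded {..0} weight \<Psi>"
    using \<Phi> \<Psi> by (auto simp: lp_solution_def)
  obtain C C' where C: "\<And>t. t \<le> 0 \<Longrightarrow> weight t * sum_norm (\<Phi> t) \<le> C" "\<And>t. t \<le> 0 \<Longrightarrow> weight t * sum_norm (\<Psi> t) \<le> C'"
    using wb unfolding weighted_bounded_def by (metis atMost_iff)
  show ?thesis
  proof (rule bound_by_contraction[where I="{..0}" and h="\<lambda>t. weight t * sum_norm (\<Phi> t - \<Psi> t)" and M="C + C'"])
    fix s :: real assume "s \<in> {..0}"
    hence s: "s \<le> 0" by simp
    have "weight s * sum_norm (\<Phi> s - \<Psi> s) \<le> weight s * (sum_norm (\<Phi> s) + sum_norm (\<Psi> s))"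
      by (intro mult_left_mono sum_norm_minus_le) (simp add: weight_def)
    thus "weight s * sum_norm (\<Phi> s - \<Psi> s) \<le> C + C'" using C(1)[OF s] C(2)[OF s] by (simp add: distrib_left)
  next
    fix M s :: real assume M: "\<And>t. t \<in> {..0} \<Longrightarrow> weight t * sum_norm (\<Phi> t - \<Psi> t) \<le> M" and "s \<in> {..0}"
    thus "weight s * sum_norm (\<Phi> s - \<Psi> s) \<le> norm (x - x') + rate * M"
      using lp_map_contraction(2)[OF wb, of M s x x'] \<Phi> \<Psi> by (simp add: lp_solution_def)
  qed (use rate t in auto)
qed

lemma lp_solution_unique:
  assumes "lp_solution x \<Phi>" "lp_solution x \<Psi>" "t \<le> 0"
  shows "\<Phi> t = \<Psi> t"
proof -
  have "weight t * sum_norm (\<Phi> t - \<Psi> t) \<le> 0" using lp_solution_lipschitz[OF assms] by simp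
  hence "sum_norm (\<Phi> t - \<Psi> t) \<le> 0" by (simp add: weight_def mult_le_0_iff)
  hence "sum_norm (\<Phi> t - \<Psi> t) = 0" by (rule antisym) simp
  thus ?thesis by simp
qed

text \<open>The share \<open>K / (\<eta> - b)\<close> of the stable component meets the distance
  \<open>norm (x - x') / (1 - rate)\<close> of the fixed points, at time 0, where the weight is
  1.\<close>

lemma lp_solution_backward_lipschitz:
  assumes \<Phi>: "lp_solution x \<Phi>" and \<Psi>: "lp_solution x' \<Psi>"
  shows "norm (backward (\<lambda>s. g s (\<Phi> s)) 0 - backward (\<lambda>s. g s (\<Psi> s)) 0) \<le> K / ((\<eta> - b) * (1 - rate)) * norm (x - x')"
  using lp_map_contraction(1)[OF _ _ lp_solution_lipschitz[OF assms], of 0] assms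
  by (simp add: lp_solution_def mult.commute)

lemma lp_solution_integrable:
  assumes \<Phi>: "weighted_bounded {..0} weight \<Phi>" and t: "t \<le> 0"
  shows "set_integrable lborel {..t} (\<lambda>s. mat_exp ((t - s) *\<^sub>R B) *v g s (\<Phi> s))"
    and "interval_lebesgue_integrable lborel (ereal 0) (ereal t) (\<lambda>s. mat_exp ((t - s) *\<^sub>R A) *v f s (\<Phi> s))"
proof -
  define P where "P s = \<Phi> (min s 0)" for s
  have P: "continuous_on UNIV P" "weighted_bounded {..0} weight P"
    unfolding P_def using weighted_bounded_clip[OF \<Phi>] by auto
  have eq: "P s = \<Phi> s" if "s \<le> 0" for s using that by (simp add: P_def)
  have "set_integrable lborel {..t} (\<lambda>s. mat_exp ((t - s) *\<^sub>R B) *v g s (\<Phi> s))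
      \<longleftrightarrow> set_integrable lborel {..t} (\<lambda>s. mat_exp ((t - s) *\<^sub>R B) *v g s (P s))"
    using t by (intro set_integrable_cong) (auto simp: eq)
  thus "set_integrable lborel {..t} (\<lambda>s. mat_exp ((t - s) *\<^sub>R B) *v g s (\<Phi> s))"
    using backward_integrable(1)[OF P t] by simp
  have "interval_lebesgue_integrable lborel (ereal 0) (ereal t) (\<lambda>s. mat_exp ((t - s) *\<^sub>R A) *v f s (\<Phi> s))
      \<longleftrightarrow> interval_lebesgue_integrable lborel (ereal 0) (ereal t) (\<lambda>s. mat_exp ((t - s) *\<^sub>R A) *v f s (P s))"
    using t by (intro primitive_cong(2)) (auto simp: eq closed_segment_eq_real_ivl split: if_splits)
  moreover have "loc_integrable (\<lambda>s. mat_exp ((t - s) *\<^sub>R A) *v f s (P s))"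
    by (intro loc_integrable_mat_exp tame_loc_integrable[OF f] P continuous_intros)
  ultimately show "interval_lebesgue_integrable lborel (ereal 0) (ereal t) (\<lambda>s. mat_exp ((t - s) *\<^sub>R A) *v f s (\<Phi> s))"
    by (simp add: loc_integrable_iff_interval)
qed

text \<open>By variation of constants a fixed point is an orbit of \<open>field\<close> on the half
  line, with the backward integral at 0 as its stable initial value. The extension \<open>P\<close>
  is constant for positive times, so the equation is claimed for \<open>t \<le> 0\<close>
  only.\<close>

lemma lp_solution_imp_flow:
  assumes \<Phi>: "lp_solution x \<Phi>"
  defines "P \<equiv> \<lambda>t. \<Phi> (min t 0)"
  shows "continuous_on UNIV P" "t \<le> 0 \<Longrightarrow> P t = (x, backward (\<lambda>s. g s (\<Phi> s)) 0) + primitive (\<lambda>s. field s (P s)) t"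
proof -
  have wb: "weighted_bounded {..0} weight \<Phi>" using \<Phi> by (simp add: lp_solution_def)
  have P: "continuous_on UNIV P" "weighted_bounded {..0} weight P"
    unfolding P_def using weighted_bounded_clip[OF wb] by auto
  show "continuous_on UNIV P" by (rule P)
  have eq: "P s = \<Phi> s" if "s \<le> 0" for s using that by (simp add: P_def)
  define v0 where "v0 = backward (\<lambda>s. g s (P s)) 0"
  \<comment> \<open>\<open>U\<close> and \<open>V\<close> solve linear equations driven by
    \<open>P\<close> on the whole line and agree with the components of \<open>P\<close> for
    nonpositive times.\<close>
  define U where "U t = mat_exp (t *\<^sub>R A) *v (x + primitive (\<lambda>s. mat_exp (- s *\<^sub>R A) *v f s (P s)) t)" for t
  define V where "V t = mat_exp (t *\<^sub>R B) *v (v0 + primitive (\<lambda>s. mat_exp (- s *\<^sub>R B) *v g s (P s)) t)" for t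
  have PUV: "P s = (U s, V s)" if "s \<le> 0" for s
    using lp_map_variation[OF P that, of x] lp_map_cong[of P \<Phi> s x] eq \<Phi> eq[OF that] that
    by (simp add: lp_solution_def U_def V_def v0_def)
  have v0: "v0 = backward (\<lambda>s. g s (\<Phi> s)) 0"
    unfolding v0_def backward_def by (auto intro!: set_lebesgue_integral_cong simp: eq)
  note U = variation_of_constants_solves[OF D tame_loc_integrable[OF f P(1)] tame_isCont[OF f P(1)], where M=A and ?u0.0=x, folded U_def]
  note V = variation_of_constants_solves[OF D tame_loc_integrable[OF g P(1)] tame_isCont[OF g P(1)], where M=B and ?u0.0=v0, folded V_def]
  show "P t = (x, backward (\<lambda>s. g s (\<Phi> s)) 0) + primitive (\<lambda>s. field s (P s)) t" if t: "t \<le> 0"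
  proof -
    have "primitive (\<lambda>s. A *v U s + f s (P s)) t = primitive (\<lambda>s. A *v fst (P s) + f s (P s)) t"
      "primitive (\<lambda>s. B *v V s + g s (P s)) t = primitive (\<lambda>s. B *v snd (P s) + g s (P s)) t"
      using t by (auto intro!: primitive_cong(1) simp: PUV closed_segment_eq_real_ivl split: if_splits)
    hence "(U t, V t) = (x, v0) + (primitive (\<lambda>s. A *v fst (P s) + f s (P s)) t, primitive (\<lambda>s. B *v snd (P s) + g s (P s)) t)"
      using U[of t] V[of t] by simp
    thus ?thesis
      unfolding field_def primitive_Pair(2)[OF field_integrable[OF P(1)]] PUV[OF t] by (simp add: v0)
  qed
qed

text \<open>The stable initial value is forced. Both \<open>snd (\<Phi> t)\<close> and the backward
  integral have variation of constants form with the same driving term, so their difference is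
  \<open>mat_exp (t *\<^sub>R B) *v (snd p - v0)\<close>. It is at most a constant times
  \<open>exp (\<eta> * t)\<close>, and undoing the exponential costs \<open>exp (- b * t)\<close>.
  The resulting \<open>exp ((\<eta> - b) * t)\<close> tends to 0 at minus infinity, so
  \<open>snd p = v0\<close>.\<close>

lemma flow_imp_lp_solution:
  assumes \<Phi>: "continuous_on UNIV \<Phi>" "weighted_bounded {..0} weight \<Phi>"
    and sol: "\<And>t. \<Phi> t = p + primitive (\<lambda>s. field s (\<Phi> s)) t"
  shows "lp_solution (fst p) \<Phi>"
proof -
  have *: "\<Phi> t = p + (primitive (\<lambda>s. A *v fst (\<Phi> s) + f s (\<Phi> s)) t, primitive (\<lambda>s. B *v snd (\<Phi> s) + g s (\<Phi> s)) t)" for t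
    using sol[of t] unfolding field_def primitive_Pair(2)[OF field_integrable[OF \<Phi>(1)]] .
  have U: "fst (\<Phi> t) = fst p + primitive (\<lambda>s. A *v fst (\<Phi> s) + f s (\<Phi> s)) t"
    and V: "snd (\<Phi> t) = snd p + primitive (\<lambda>s. B *v snd (\<Phi> s) + g s (\<Phi> s)) t" for t
    using arg_cong[OF *[of t], of fst] arg_cong[OF *[of t], of snd] by simp_all
  define v0 where "v0 = backward (\<lambda>s. g s (\<Phi> s)) 0"
  let ?J = "\<lambda>t. primitive (\<lambda>s. mat_exp (- s *\<^sub>R B) *v g s (\<Phi> s)) t"
  have U': "fst (\<Phi> t) = mat_exp (t *\<^sub>R A) *v (fst p + primitive (\<lambda>s. mat_exp (- s *\<^sub>R A) *v f s (\<Phi> s)) t)" for t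
    by (rule variation_of_constants_unique[OF D tame_loc_integrable[OF f \<Phi>(1)] tame_isCont[OF f \<Phi>(1)] _ U])
      (auto intro!: continuous_intros \<Phi>)
  have V': "snd (\<Phi> t) = mat_exp (t *\<^sub>R B) *v (snd p + ?J t)" for t
    by (rule variation_of_constants_unique[OF D tame_loc_integrable[OF g \<Phi>(1)] tame_isCont[OF g \<Phi>(1)] _ V])
      (auto intro!: continuous_intros \<Phi>)
  obtain C where C: "\<And>t. t \<le> 0 \<Longrightarrow> weight t * sum_norm (\<Phi> t) \<le> C" using \<Phi>(2) by (auto simp: weighted_bounded_def)
  obtain C' where C': "\<And>t. t \<le> 0 \<Longrightarrow> norm (backward (\<lambda>s. g s (\<Phi> s)) t) \<le> C' * exp (\<eta> * t)"
    using backward_integrable(2)[OF \<Phi>, of 0] by auto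
  have small: "norm (snd p - v0) \<le> (C + C') * exp ((\<eta> - b) * t)" if t: "t \<le> 0" for t
  proof -
    have "snd (\<Phi> t) - backward (\<lambda>s. g s (\<Phi> s)) t = mat_exp (t *\<^sub>R B) *v (snd p - v0)"
      unfolding V' backward_split[OF \<Phi> t] v0_def by (simp flip: matrix_vector_mult_diff_distrib)
    hence "snd p - v0 = mat_exp (- t *\<^sub>R B) *v (snd (\<Phi> t) - backward (\<lambda>s. g s (\<Phi> s)) t)"
      by (metis mat_exp_inverse_vec')
    also have "norm \<dots> \<le> exp (b * (- t)) * norm (snd (\<Phi> t) - backward (\<lambda>s. g s (\<Phi> s)) t)"
      using t by (intro expB) simp
    also have "\<dots> \<le> exp (b * (- t)) * ((C + C') * exp (\<eta> * t))"
    proof (intro mult_left_mono)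
      have "norm (snd (\<Phi> t)) \<le> sum_norm (\<Phi> t)" by (simp add: sum_norm_def)
      also have "\<dots> \<le> C * exp (\<eta> * t)" using C[OF t] by (simp add: weight_def exp_minus field_simps)
      finally show "norm (snd (\<Phi> t) - backward (\<lambda>s. g s (\<Phi> s)) t) \<le> (C + C') * exp (\<eta> * t)"
        using C'[OF t] norm_triangle_ineq4[of "snd (\<Phi> t)" "backward (\<lambda>s. g s (\<Phi> s)) t"] by (simp add: distrib_right)
    qed simp
    also have "\<dots> = (C + C') * exp ((\<eta> - b) * t)" by (simp add: algebra_simps flip: exp_add)
    finally show ?thesis .
  qed
  have "((\<lambda>t. (C + C') * exp ((\<eta> - b) * t)) \<longlongrightarrow> (C + C') * 0) at_bot"
    using \<eta> by (intro tendsto_intros filterlim_compose[OF exp_at_bot]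
        filterlim_tendsto_pos_mult_at_bot[OF tendsto_const] filterlim_ident) auto
  moreover have "eventually (\<lambda>t. norm (snd p - v0) \<le> (C + C') * exp ((\<eta> - b) * t)) at_bot"
    using eventually_le_at_bot[of 0] by eventually_elim (rule small)
  ultimately have "norm (snd p - v0) \<le> (C + C') * 0"
    by (rule tendsto_lowerbound) simp
  hence "snd p = v0" by simp
  hence "\<Phi> t = lp_map (fst p) \<Phi> t" if "t \<le> 0" for t
    using lp_map_variation[OF \<Phi> that, of "fst p"] U'[of t] V'[of t] by (simp add: prod_eq_iff v0_def)
  thus ?thesis using \<Phi>(2) by (simp add: lp_solution_def)
qed

end

section \<open>The random differential equation\<close>

lemma loc_integrable_scaleR:
  assumes "continuous_on UNIV c" "loc_integrable y"
  shows "loc_integrable (\<lambda>s. c s *\<^sub>R y s)"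
proof (rule loc_integrable_bound[OF assms(2)])
  show "(\<lambda>s. c s *\<^sub>R y s) \<in> borel_measurable borel"
    by (intro borel_measurable_scaleR borel_measurable_continuous_onI assms loc_integrable_measurable)
  show "continuous_on UNIV (\<lambda>s. \<bar>c s\<bar>)" by (intro continuous_intros assms)
qed simp

lemma loc_integrable_interval:
  "loc_integrable g \<Longrightarrow> interval_lebesgue_integrable lborel (ereal s) (ereal t) g"
  by (auto simp: loc_integrable_def interval_lebesgue_integrable_def
      intro: set_integrable_subset[OF _ _ greaterThanLessThan_subseteq_atLeastAtMost_iff[THEN iffD2]])

lemma primitive_scaleR: "primitive (\<lambda>s. c *\<^sub>R y s) t = c *\<^sub>R primitive y t"
  by (simp add: primitive_def interval_lebesgue_integral_def scaleR_minus_right)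

locale rde =
  fixes \<omega> :: "real \<Rightarrow> real" and A :: "real^'n^'n" and B :: "real^'m^'m"
    and f :: "real^'n \<Rightarrow> real^'m \<Rightarrow> real^'n" and g :: "real^'n \<Rightarrow> real^'m \<Rightarrow> real^'m"
    and K :: real
  assumes cadlag: "cadlag (zeta \<omega>)"
    and integrable: "\<And>t. interval_lebesgue_integrable lborel (ereal 0) (ereal t) (zeta \<omega>)"
    and f0: "f 0 0 = 0" and g0: "g 0 0 = 0"
    and f_lip: "\<And>x1 y1 x2 y2. norm (f x1 y1 - f x2 y2) \<le> K * (norm (x1 - x2) + norm (y1 - y2))"
    and g_lip: "\<And>x1 y1 x2 y2. norm (g x1 y1 - g x2 y2) \<le> K * (norm (x1 - x2) + norm (y1 - y2))"
begin

abbreviation Z :: "real \<Rightarrow> real" where "Z \<equiv> primitive (zeta \<omega>)"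

abbreviation D :: "real set" where "D \<equiv> discont (zeta \<omega>)"

definition transformed :: "(real^'n \<Rightarrow> real^'m \<Rightarrow> 'c::real_vector) \<Rightarrow> real \<Rightarrow> (real^'n) \<times> (real^'m) \<Rightarrow> 'c" where
  "transformed h t P = exp (- Z t) *\<^sub>R Ftr \<omega> h (exp (Z t) *\<^sub>R fst P) (exp (Z t) *\<^sub>R snd P) t"

definition transformed_field :: "real \<Rightarrow> (real^'n) \<times> (real^'m) \<Rightarrow> (real^'n) \<times> (real^'m)" where
  "transformed_field t P = (A *v fst P + transformed f t P, B *v snd P + transformed g t P)"

lemma zeta_loc_integrable: "loc_integrable (zeta \<omega>)"
  by (simp add: loc_integrable_iff_interval integrable)

lemma countable_D: "countable D"
  by (rule cadlag_countable_discont[OF cadlag])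

lemma continuous_Z [continuous_intros]: "continuous_on S Z"
  by (rule continuous_on_subset[OF continuous_primitive[OF zeta_loc_integrable]]) simp

lemma isCont_Z: "isCont Z t"
  using continuous_Z[of UNIV] by (simp add: continuous_on_eq_continuous_at)

text \<open>Additivity splits \<open>exp (Iz \<omega> s t)\<close> into a factor in \<open>t\<close>
  and a factor in \<open>s\<close>; this is why the change of coordinates removes it from the
  integrals.\<close>

lemma Iz_eq: "Iz \<omega> s t = Z t - Z s"
proof -
  have "(LBINT x=ereal 0..ereal s. zeta \<omega> x) + (LBINT x=ereal s..ereal t. zeta \<omega> x) = (LBINT x=ereal 0..ereal t. zeta \<omega> x)"
    by (rule interval_integral_sum)
      (simp add: loc_integrable_interval[OF zeta_loc_integrable] flip: ereal_min ereal_max)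
  thus ?thesis by (simp add: Iz_def primitive_def)
qed

lemma transformed_eq:
  "transformed h t P = exp (- (zeta \<omega> t + Z t)) *\<^sub>R
    h (exp (zeta \<omega> t + Z t) *\<^sub>R fst P) (exp (zeta \<omega> t + Z t) *\<^sub>R snd P)"
  by (simp add: transformed_def Ftr_def exp_add exp_minus exp_diff divide_inverse mult_ac)

text \<open>The scalar \<open>exp (c t)\<close> multiplies differences inside \<open>h\<close>, and
  its inverse multiplies them outside, so the constant \<open>K\<close> is the same at all times,
  whatever the size of \<open>zeta \<omega> t\<close>. The exponent \<open>c\<close> is continuous
  off \<open>D\<close>, which gives the regularity in time.\<close>

lemma tame_transformed:
  fixes h :: "real^'n \<Rightarrow> real^'m \<Rightarrow> 'c::euclidean_space"
  assumes h0: "h 0 0 = 0"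
    and lip: "\<And>x1 y1 x2 y2. norm (h x1 y1 - h x2 y2) \<le> K * (norm (x1 - x2) + norm (y1 - y2))"
  shows "tame D K (transformed h)"
proof -
  define H where "H p = h (fst p) (snd p)" for p
  have "lipschitz_on (2 * \<bar>K\<bar>) UNIV H"
  proof (rule lipschitz_onI)
    fix p q
    have "dist (H p) (H q) \<le> K * sum_norm (p - q)"
      using lip[of "fst p" "snd p" "fst q" "snd q"] by (simp add: H_def dist_norm sum_norm_def)
    also have "\<dots> \<le> \<bar>K\<bar> * sum_norm (p - q)" by (intro mult_right_mono) auto
    also have "\<dots> \<le> \<bar>K\<bar> * (2 * norm (p - q))" by (intro mult_left_mono sum_norm_le_2_norm) auto
    finally show "dist (H p) (H q) \<le> 2 * \<bar>K\<bar> * dist p q" by (simp add: dist_norm)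
  qed simp
  hence H: "continuous_on UNIV H" by (rule lipschitz_on_continuous_on)
  define c where "c t = zeta \<omega> t + Z t" for t
  have cH: "transformed h t P = exp (- c t) *\<^sub>R H (exp (c t) *\<^sub>R P)" for t P
    by (simp add: transformed_eq H_def c_def)
  have c_meas: "c \<in> borel_measurable borel"
    unfolding c_def
    by (intro borel_measurable_add loc_integrable_measurable[OF zeta_loc_integrable]
        borel_measurable_continuous_onI continuous_Z)
  have c_cont: "isCont c t" if "t \<notin> D" for t
    using that isCont_Z unfolding c_def discont_def by (intro continuous_add) auto
  show ?thesis
    unfolding tame_def
  proof (intro conjI allI impI)
    fix t P Q
    have "norm (transformed h t P - transformed h t Q) = exp (- c t) * norm (H (exp (c t) *\<^sub>R P) - H (exp (c t) *\<^sub>R Q))"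
      by (simp add: cH flip: scaleR_right_diff_distrib)
    also have "\<dots> \<le> exp (- c t) * (K * (norm (exp (c t) *\<^sub>R fst P - exp (c t) *\<^sub>R fst Q) + norm (exp (c t) *\<^sub>R snd P - exp (c t) *\<^sub>R snd Q)))"
      unfolding H_def fst_scaleR snd_scaleR by (intro mult_left_mono lip) simp
    also have "\<dots> = exp (- c t) * (K * (exp (c t) * norm (fst P - fst Q) + exp (c t) * norm (snd P - snd Q)))"
      by (simp flip: scaleR_right_diff_distrib)
    also have "\<dots> = (exp (- c t) * exp (c t)) * (K * sum_norm (P - Q))"
      by (simp add: sum_norm_def algebra_simps)
    also have "\<dots> = K * sum_norm (P - Q)" by (simp flip: exp_add)
    finally show "norm (transformed h t P - transformed h t Q) \<le> K * sum_norm (P - Q)" .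
  next
    show "transformed h t 0 = 0" for t by (simp add: transformed_eq h0)
  next
    fix \<Phi> :: "real \<Rightarrow> (real^'n) \<times> (real^'m)" assume \<Phi>: "continuous_on UNIV \<Phi>"
    have "(\<lambda>t. exp (- c t)) \<in> borel_measurable borel" "(\<lambda>t. exp (c t)) \<in> borel_measurable borel"
      using c_meas by measurable
    thus "(\<lambda>t. transformed h t (\<Phi> t)) \<in> borel_measurable borel"
      unfolding cH
      by (intro borel_measurable_scaleR borel_measurable_continuous_on[OF H]
          borel_measurable_continuous_onI[OF \<Phi>])
  next
    fix \<Phi> :: "real \<Rightarrow> (real^'n) \<times> (real^'m)" and t assume "isCont \<Phi> t" "t \<notin> D"
    hence "isCont (\<lambda>t. exp (c t) *\<^sub>R \<Phi> t) t" "isCont (\<lambda>t. exp (- c t)) t"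
      by (auto intro!: continuous_intros c_cont)
    moreover have "isCont H x" for x using H unfolding continuous_on_eq_continuous_at[OF open_UNIV] by blast
    ultimately have "isCont (\<lambda>t. exp (- c t)) t" "isCont (\<lambda>t. H (exp (c t) *\<^sub>R \<Phi> t)) t"
      using isCont_o2 by blast+
    thus "isCont (\<lambda>t. transformed h t (\<Phi> t)) t"
      unfolding cH by (rule continuous_scaleR)
  qed
qed

lemmas tame_f = tame_transformed[OF f0 f_lip] and tame_g = tame_transformed[OF g0 g_lip]

lemma tame_transformed_field: "\<exists>L. tame D L transformed_field"
  unfolding transformed_field_def[abs_def] by (rule tame_linear_plus_Pair[OF tame_f tame_g])

lemma rde_rhs_eq:
  "rde_rhs \<omega> A B f g t p = exp (Z t) *\<^sub>R transformed_field t (exp (- Z t) *\<^sub>R p) + zeta \<omega> t *\<^sub>R p"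
  by (simp add: rde_rhs_def transformed_field_def transformed_def exp_minus prod_eq_iff scaleR_right_distrib
      matrix_vector_mult_scaleR)

lemma exp_Z_has_derivative:
  assumes "t \<notin> D"
  shows "((\<lambda>t. exp (c * Z t)) has_real_derivative exp (c * Z t) * (c * zeta \<omega> t)) (at t)"
proof -
  have "(Z has_real_derivative zeta \<omega> t) (at t)"
    using primitive_has_vector_derivative[OF zeta_loc_integrable] assms
    by (simp add: discont_def has_real_derivative_iff_has_vector_derivative)
  thus ?thesis by (auto intro!: derivative_eq_intros)
qed

lemma rde_rhs_regular:
  assumes s: "continuous_on UNIV s"
  shows "loc_integrable (\<lambda>r. rde_rhs \<omega> A B f g r (s r))"
    and "t \<notin> D \<Longrightarrow> isCont (\<lambda>r. rde_rhs \<omega> A B f g r (s r)) t"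
proof -
  obtain L where L: "tame D L transformed_field" using tame_transformed_field by blast
  have S: "continuous_on UNIV (\<lambda>r. exp (- Z r) *\<^sub>R s r)" by (intro continuous_intros s)
  have "loc_integrable (\<lambda>r. zeta \<omega> r *\<^sub>R s r)"
  proof (rule loc_integrable_bound[OF zeta_loc_integrable])
    show "(\<lambda>r. zeta \<omega> r *\<^sub>R s r) \<in> borel_measurable borel"
      by (intro borel_measurable_scaleR borel_measurable_continuous_onI s
          loc_integrable_measurable zeta_loc_integrable)
    show "continuous_on UNIV (\<lambda>r. norm (s r))" by (intro continuous_intros s)
  qed (simp add: mult.commute)
  moreover have "loc_integrable (\<lambda>r. exp (Z r) *\<^sub>R transformed_field r (exp (- Z r) *\<^sub>R s r))"
    by (intro loc_integrable_scaleR tame_loc_integrable[OF L S] continuous_intros)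
  ultimately show "loc_integrable (\<lambda>r. rde_rhs \<omega> A B f g r (s r))"
    unfolding rde_rhs_eq by (intro loc_integrable_add)
  assume t: "t \<notin> D"
  have "isCont (zeta \<omega>) t" using t by (simp add: discont_def)
  moreover have "isCont s t" using s by (simp add: continuous_on_eq_continuous_at)
  ultimately show "isCont (\<lambda>r. rde_rhs \<omega> A B f g r (s r)) t"
    unfolding rde_rhs_eq
    by (intro continuous_add continuous_scaleR tame_isCont[OF L S t] continuous_exp isCont_Z)
qed

text \<open>Each integral equation is differentiated off \<open>D\<close>, where the integrand is
  continuous. The product rule with the factor \<open>exp (- Z t)\<close> cancels the term
  \<open>zeta \<omega> t *\<^sub>R s t\<close>, and with \<open>exp (Z t)\<close> it restores it;
  integrating again gives the other equation.\<close>

lemma is_rde_sol_iff: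
  "is_rde_sol \<omega> A B f g p s \<longleftrightarrow> continuous_on UNIV (\<lambda>t. exp (- Z t) *\<^sub>R s t) \<and>
    (\<forall>t. exp (- Z t) *\<^sub>R s t = p + primitive (\<lambda>r. transformed_field r (exp (- Z r) *\<^sub>R s r)) t)"
  (is "_ \<longleftrightarrow> ?cont \<and> ?eq")
proof -
  obtain L where L: "tame D L transformed_field" using tame_transformed_field by blast
  let ?S = "\<lambda>t. exp (- Z t) *\<^sub>R s t"
  let ?R = "\<lambda>r. rde_rhs \<omega> A B f g r (s r)"
  have cont_iff: "?cont \<longleftrightarrow> continuous_on UNIV s"
  proof
    assume ?cont
    hence "continuous_on UNIV (\<lambda>t. exp (Z t) *\<^sub>R ?S t)"
      by (rule continuous_on_scaleR[OF continuous_on_exp[OF continuous_Z]])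
    thus "continuous_on UNIV s" by (simp flip: exp_add)
  qed (intro continuous_intros)
  have "is_rde_sol \<omega> A B f g p s \<longleftrightarrow> continuous_on UNIV s \<and> (\<forall>t. s t = p + primitive ?R t)"
    using rde_rhs_regular(1)[of s] by (auto simp: is_rde_sol_def primitive_def loc_integrable_iff_interval)
  also have "\<dots> \<longleftrightarrow> ?cont \<and> ?eq"
  proof
    assume *: "continuous_on UNIV s \<and> (\<forall>t. s t = p + primitive ?R t)"
    hence s: "continuous_on UNIV s" and S: ?cont using cont_iff by blast+
    have s_eq: "(\<lambda>t. p + primitive ?R t) = s" by (rule ext) (use * in metis)
    have "(s has_vector_derivative ?R t) (at t)" if "t \<notin> D" for t
    proof -
      have "((\<lambda>t. p + primitive ?R t) has_vector_derivative ?R t) (at t)"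
        using primitive_has_vector_derivative[OF rde_rhs_regular(1)[OF s] rde_rhs_regular(2)[OF s that]]
        by (auto intro!: derivative_eq_intros)
      thus ?thesis unfolding s_eq .
    qed
    hence "(?S has_vector_derivative transformed_field t (?S t)) (at t)" if "t \<notin> D" for t
      using has_vector_derivative_scaleR[OF exp_Z_has_derivative[OF that, of "-1"], of s "?R t"] that
      by (simp add: rde_rhs_eq scaleR_right_distrib flip: exp_add)
    from eq_primitive_if_deriv_off_countable[OF countable_D tame_loc_integrable[OF L S] S tame_isCont[OF L S] this]
    have "?S t = ?S 0 + primitive (\<lambda>r. transformed_field r (?S r)) t" for t .
    moreover have "?S 0 = p" using fun_cong[OF s_eq, of 0] by simp
    ultimately have ?eq by metis
    with S show "?cont \<and> ?eq" by blast
  next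
    assume *: "?cont \<and> ?eq"
    hence s: "continuous_on UNIV s" and S: ?cont using cont_iff by blast+
    have S_eq: "(\<lambda>t. p + primitive (\<lambda>r. transformed_field r (?S r)) t) = ?S"
      by (rule ext) (use * in metis)
    have "(s has_vector_derivative ?R t) (at t)" if "t \<notin> D" for t
    proof -
      have "((\<lambda>t. p + primitive (\<lambda>r. transformed_field r (?S r)) t) has_vector_derivative transformed_field t (?S t)) (at t)"
        using primitive_has_vector_derivative[OF tame_loc_integrable[OF L S] tame_isCont[OF L S that]]
        by (auto intro!: derivative_eq_intros)
      hence "(?S has_vector_derivative transformed_field t (?S t)) (at t)" unfolding S_eq .
      from has_vector_derivative_scaleR[OF exp_Z_has_derivative[OF that, of 1] this]
      moreover have "exp (Z t) * zeta \<omega> t * exp (- Z t) = zeta \<omega> t" by (simp add: exp_minus)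
      ultimately show ?thesis by (simp add: rde_rhs_eq add.commute flip: exp_add)
    qed
    from eq_primitive_if_deriv_off_countable[OF countable_D rde_rhs_regular(1)[OF s] s rde_rhs_regular(2)[OF s] this]
    have "s t = s 0 + primitive ?R t" for t .
    moreover have "s 0 = p" using fun_cong[OF S_eq, of 0] by simp
    ultimately have "\<forall>t. s t = p + primitive ?R t" by metis
    with s show "continuous_on UNIV s \<and> (\<forall>t. s t = p + primitive ?R t)" by blast
  qed
  finally show ?thesis .
qed

definition flow :: "(real^'n) \<times> (real^'m) \<Rightarrow> real \<Rightarrow> (real^'n) \<times> (real^'m)" where
  "flow p t = exp (- Z t) *\<^sub>R phi \<omega> A B f g t p"

lemma phi_eq_flow: "phi \<omega> A B f g t p = exp (Z t) *\<^sub>R flow p t"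
  by (simp add: flow_def flip: exp_add)

text \<open>\<open>phi\<close> is a definite description, so it satisfies its equation only once
  existence and uniqueness are established. Both are carried over from the transformed system by
  \<open>is_rde_sol_iff\<close>.\<close>

lemma flow:
  "continuous_on UNIV (flow p)" "flow p t = p + primitive (\<lambda>r. transformed_field r (flow p r)) t"
proof -
  obtain L where L: "tame D L transformed_field" using tame_transformed_field by blast
  obtain S where S: "continuous_on UNIV S" "\<And>t. S t = p + primitive (\<lambda>r. transformed_field r (S r)) t"
    using flow_exists[OF L] by blast
  have "\<exists>!s. is_rde_sol \<omega> A B f g p s"
  proof (rule ex1I)
    have *: "exp (- Z t) *\<^sub>R (exp (Z t) *\<^sub>R S t) = S t" for t by (simp flip: exp_add)
    show "is_rde_sol \<omega> A B f g p (\<lambda>t. exp (Z t) *\<^sub>R S t)"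
      unfolding is_rde_sol_iff * using S by blast
    fix s assume "is_rde_sol \<omega> A B f g p s"
    hence s: "continuous_on UNIV (\<lambda>t. exp (- Z t) *\<^sub>R s t)"
      "\<And>t. exp (- Z t) *\<^sub>R s t = p + primitive (\<lambda>r. transformed_field r (exp (- Z r) *\<^sub>R s r)) t"
      unfolding is_rde_sol_iff by blast+
    have "exp (- Z t) *\<^sub>R s t = S t" for t
      by (rule flow_unique[OF L s(1) S(1) s(2) S(2)])
    hence "s t = exp (Z t) *\<^sub>R S t" for t by (simp add: exp_minus_inverse flip: exp_add \<open>\<And>t. exp (- Z t) *\<^sub>R s t = S t\<close>)
    thus "s = (\<lambda>t. exp (Z t) *\<^sub>R S t)" by (rule ext)
  qed
  from theI'[OF this] have "is_rde_sol \<omega> A B f g p (\<lambda>t. phi \<omega> A B f g t p)"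
    unfolding phi_def .
  thus "continuous_on UNIV (flow p)" "flow p t = p + primitive (\<lambda>r. transformed_field r (flow p r)) t"
    unfolding is_rde_sol_iff flow_def[symmetric] by blast+
qed

end

section \<open>Fibers through a base point\<close>

locale rde_fiber = rde \<omega> A B f g K
  for \<omega> :: "real \<Rightarrow> real" and A :: "real^'n^'n" and B :: "real^'m^'m"
    and f :: "real^'n \<Rightarrow> real^'m \<Rightarrow> real^'n" and g :: "real^'n \<Rightarrow> real^'m \<Rightarrow> real^'m"
    and K :: real +
  fixes a b \<eta> :: real and p0 :: "(real^'n) \<times> (real^'m)"
  assumes expA: "\<And>t x. t \<le> 0 \<Longrightarrow> norm (mat_exp (t *\<^sub>R A) *v x) \<le> exp (a * t) * norm x"
    and expB: "\<And>t y. t \<ge> 0 \<Longrightarrow> norm (mat_exp (t *\<^sub>R B) *v y) \<le> exp (b * t) * norm y"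
    and \<eta>: "b < \<eta>" "\<eta> < a"
    and gap: "K * (1 / (\<eta> - b) + 1 / (a - \<eta>)) < 1"
begin

definition incr :: "(real^'n \<Rightarrow> real^'m \<Rightarrow> 'c::real_vector) \<Rightarrow> real \<Rightarrow> (real^'n) \<times> (real^'m) \<Rightarrow> 'c" where
  "incr h t P = transformed h t (P + flow p0 t) - transformed h t (flow p0 t)"

text \<open>Here the random objects enter the deterministic core: the linear parts stay, and the
  nonlinearities become increments along the orbit of \<open>p0\<close>, still tame with the same
  \<open>K\<close> by \<open>tame_shift\<close>.\<close>

sublocale dichotomy A B a b \<eta> K D "incr f" "incr g"
  using expA expB \<eta> gap countable_D tame_shift[OF tame_f flow(1), of p0] tame_shift[OF tame_g flow(1), of p0]
  by unfold_locales (auto simp: incr_def[abs_def])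

abbreviation rescale :: "(real \<Rightarrow> (real^'n) \<times> (real^'m)) \<Rightarrow> real \<Rightarrow> (real^'n) \<times> (real^'m)" where
  "rescale \<phi> t \<equiv> exp (- Z t) *\<^sub>R \<phi> t"

lemma Delta_eq: "Delta \<omega> A B f g h p0 t q = exp (Z t) *\<^sub>R incr h t (exp (- Z t) *\<^sub>R q)"
  by (simp add: Delta_def incr_def transformed_def phi_eq_flow scaleR_right_diff_distrib scaleR_right_distrib flip: exp_add)

text \<open>\<open>Delta\<close> contributes \<open>exp (Z s)\<close>, which cancels the factor
  \<open>exp (- Z s)\<close> of \<open>exp (Iz \<omega> s t)\<close>; the remaining
  \<open>exp (Z t)\<close> is constant in \<open>s\<close> and leaves the integral.\<close>

lemma integrand_eq:
  "exp (Iz \<omega> s t) *\<^sub>R (mat_exp M *v Delta \<omega> A B f g h p0 s q)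
    = exp (Z t) *\<^sub>R (mat_exp M *v incr h s (exp (- Z s) *\<^sub>R q))"
  by (simp add: Delta_eq Iz_eq matrix_vector_mult_scaleR flip: exp_add)

text \<open>The factor \<open>exp (- Z t)\<close> of the weight is absorbed by the rescaling, and
  separate bounds for the two components amount to one bound for their sum. The norm is replaced by
  an equivalent one, the space is the same.\<close>

lemma Cminus_iff: "Cminus \<omega> \<eta> \<phi> \<longleftrightarrow> weighted_bounded {..0} weight (rescale \<phi>)"
proof -
  have cont: "continuous_on {..0} \<phi> \<longleftrightarrow> continuous_on {..0} (rescale \<phi>)"
  proof
    assume "continuous_on {..0} (rescale \<phi>)"
    hence "continuous_on {..0} (\<lambda>t. exp (Z t) *\<^sub>R rescale \<phi> t)"
      by (rule continuous_on_scaleR[OF continuous_on_exp[OF continuous_Z]])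
    thus "continuous_on {..0} \<phi>" by (simp flip: exp_add)
  qed (intro continuous_intros)
  have e: "exp (- \<eta> * t - Iz \<omega> 0 t) = weight t * exp (- Z t)" for t
    by (simp add: Iz_eq weight_def flip: exp_add)
  have "bdd_above ((\<lambda>t. exp (- \<eta> * t - Iz \<omega> 0 t) * norm (fst (\<phi> t))) ` {..0}) \<and>
      bdd_above ((\<lambda>t. exp (- \<eta> * t - Iz \<omega> 0 t) * norm (snd (\<phi> t))) ` {..0})
    \<longleftrightarrow> (\<exists>C. \<forall>t\<in>{..0}. weight t * sum_norm (rescale \<phi> t) \<le> C)" (is "?L \<longleftrightarrow> ?R")
  proof
    assume ?L
    then obtain C C' where C: "\<And>t. t \<le> 0 \<Longrightarrow> weight t * exp (- Z t) * norm (fst (\<phi> t)) \<le> C"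
      "\<And>t. t \<le> 0 \<Longrightarrow> weight t * exp (- Z t) * norm (snd (\<phi> t)) \<le> C'"
      unfolding e bdd_above_def by auto
    show ?R
      by (rule exI[of _ "C + C'"]) (use C in \<open>force simp: sum_norm_def distrib_left mult.assoc intro: add_mono\<close>)
  next
    assume ?R
    then obtain C where C: "\<And>t. t \<le> 0 \<Longrightarrow> weight t * sum_norm (rescale \<phi> t) \<le> C" by auto
    have "weight t * exp (- Z t) * norm (fst (\<phi> t)) \<le> weight t * sum_norm (rescale \<phi> t)"
      "weight t * exp (- Z t) * norm (snd (\<phi> t)) \<le> weight t * sum_norm (rescale \<phi> t)" for t
      by (auto simp: sum_norm_def mult.assoc weight_def)
    thus ?L unfolding e by (intro conjI bdd_aboveI2[of _ _ C]) (use C order_trans in blast)+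
  qed
  thus ?thesis unfolding Cminus_def weighted_bounded_def cont by simp
qed

text \<open>The common factor \<open>exp (Z t)\<close> drops out of both equations. From right to
  left the integrability clauses of \<open>LP_sol\<close> are supplied by the weighted bound through
  \<open>lp_solution_integrable\<close>.\<close>

lemma LP_sol_iff: "LP_sol \<omega> A B f g \<eta> p0 x \<phi> \<longleftrightarrow> lp_solution x (rescale \<phi>)"
proof -
  have scale: "rescale \<phi> t = q \<longleftrightarrow> \<phi> t = exp (Z t) *\<^sub>R q" for t q
  proof
    assume "rescale \<phi> t = q"
    hence "exp (Z t) *\<^sub>R rescale \<phi> t = exp (Z t) *\<^sub>R q" by simp
    thus "\<phi> t = exp (Z t) *\<^sub>R q" by (simp flip: exp_add)
  qed (simp flip: exp_add)
  have eq: "fst (\<phi> t) = exp (Iz \<omega> 0 t) *\<^sub>R (mat_exp (t *\<^sub>R A) *v x)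
        + interval_lebesgue_integral lborel (ereal 0) (ereal t)
            (\<lambda>s. exp (Iz \<omega> s t) *\<^sub>R (mat_exp ((t - s) *\<^sub>R A) *v Delta \<omega> A B f g f p0 s (\<phi> s))) \<and>
      snd (\<phi> t) = (LINT s:{..t}|lborel. exp (Iz \<omega> s t) *\<^sub>R (mat_exp ((t - s) *\<^sub>R B) *v Delta \<omega> A B f g g p0 s (\<phi> s)))
    \<longleftrightarrow> rescale \<phi> t = lp_map x (rescale \<phi>) t" for t
    unfolding integrand_eq primitive_def[symmetric] primitive_scaleR set_integral_scaleR_right scale
    unfolding lp_map_def forward_def backward_def prod_eq_iff
    by (simp add: Iz_eq scaleR_right_distrib)
  show ?thesis
  proof
    assume "LP_sol \<omega> A B f g \<eta> p0 x \<phi>"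
    thus "lp_solution x (rescale \<phi>)"
      unfolding LP_sol_def lp_solution_def Cminus_iff eq[symmetric] by blast
  next
    assume L: "lp_solution x (rescale \<phi>)"
    hence wb: "weighted_bounded {..0} weight (rescale \<phi>)" by (simp add: lp_solution_def)
    show "LP_sol \<omega> A B f g \<eta> p0 x \<phi>"
      unfolding LP_sol_def Cminus_iff
    proof (intro conjI allI impI wb)
      fix t :: real assume t: "t \<le> 0"
      show "interval_lebesgue_integrable lborel (ereal 0) (ereal t)
          (\<lambda>s. exp (Iz \<omega> s t) *\<^sub>R (mat_exp ((t - s) *\<^sub>R A) *v Delta \<omega> A B f g f p0 s (\<phi> s)))"
        using lp_solution_integrable(2)[OF wb t]
        unfolding integrand_eq interval_lebesgue_integrable_def
        by (auto split: if_splits intro!: set_integrable_scaleR_right)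
      show "set_integrable lborel {..t}
          (\<lambda>s. exp (Iz \<omega> s t) *\<^sub>R (mat_exp ((t - s) *\<^sub>R B) *v Delta \<omega> A B f g g p0 s (\<phi> s)))"
        using lp_solution_integrable(1)[OF wb t]
        unfolding integrand_eq by (intro set_integrable_scaleR_right) auto
      have "rescale \<phi> t = lp_map x (rescale \<phi>) t" using L t by (simp add: lp_solution_def)
      note * = this[folded eq]
      show "fst (\<phi> t) = exp (Iz \<omega> 0 t) *\<^sub>R (mat_exp (t *\<^sub>R A) *v x)
        + interval_lebesgue_integral lborel (ereal 0) (ereal t)
            (\<lambda>s. exp (Iz \<omega> s t) *\<^sub>R (mat_exp ((t - s) *\<^sub>R A) *v Delta \<omega> A B f g f p0 s (\<phi> s)))"
        using * by blast
      show "snd (\<phi> t) = (LINT s:{..t}|lborel. exp (Iz \<omega> s t) *\<^sub>R (mat_exp ((t - s) *\<^sub>R B) *v Delta \<omega> A B f g g p0 s (\<phi> s)))"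
        using * by blast
    qed
  qed
qed

lemma rescale_exp: "rescale (\<lambda>t. exp (Z t) *\<^sub>R \<Phi> t) = \<Phi>"
  by (simp flip: exp_add)

lemma LP_sol_exists: "\<exists>\<phi>. LP_sol \<omega> A B f g \<eta> p0 x \<phi>"
proof -
  obtain \<Phi> where "lp_solution x \<Phi>" using lp_solution_exists by blast
  hence "LP_sol \<omega> A B f g \<eta> p0 x (\<lambda>t. exp (Z t) *\<^sub>R \<Phi> t)"
    unfolding LP_sol_iff rescale_exp .
  thus ?thesis by blast
qed

lemma LP_sol_unique:
  assumes "LP_sol \<omega> A B f g \<eta> p0 x \<phi>" "LP_sol \<omega> A B f g \<eta> p0 x \<psi>" "t \<le> 0"
  shows "\<psi> t = \<phi> t"
  using lp_solution_unique[OF assms(1,2)[unfolded LP_sol_iff] assms(3)] by simp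

lemma LP_sol_integrable:
  assumes "LP_sol \<omega> A B f g \<eta> p0 x \<phi>"
  shows "set_integrable lborel {..0} (\<lambda>s. exp (Iz \<omega> s 0) *\<^sub>R (mat_exp ((- s) *\<^sub>R B) *v Delta \<omega> A B f g g p0 s (\<phi> s)))"
proof -
  have "set_integrable lborel {..0} (\<lambda>s. exp (Iz \<omega> s 0) *\<^sub>R (mat_exp ((0 - s) *\<^sub>R B) *v Delta \<omega> A B f g g p0 s (\<phi> s)))"
    using assms unfolding LP_sol_def by blast
  thus ?thesis by simp
qed

text \<open>The path picked by \<open>SOME\<close> agrees with \<open>\<Phi>\<close> at nonpositive
  times by uniqueness, and the integral sees only such times; hence any solution computes
  \<open>lmap\<close>.\<close>

lemma lmap_eq:
  assumes \<Phi>: "lp_solution (\<xi> - fst p0) \<Phi>"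
  shows "lmap \<omega> A B f g \<eta> p0 \<xi> = snd p0 + backward (\<lambda>s. incr g s (\<Phi> s)) 0"
proof -
  define \<phi> where "\<phi> = (SOME \<phi>. LP_sol \<omega> A B f g \<eta> p0 (\<xi> - fst p0) \<phi>)"
  have "LP_sol \<omega> A B f g \<eta> p0 (\<xi> - fst p0) \<phi>" unfolding \<phi>_def by (rule someI_ex[OF LP_sol_exists])
  hence eq: "rescale \<phi> t = \<Phi> t" if "t \<le> 0" for t
    using lp_solution_unique[OF _ \<Phi> that] by (simp add: LP_sol_iff)
  have "lmap \<omega> A B f g \<eta> p0 \<xi> = snd p0 + (LINT s:{..0}|lborel. mat_exp (- s *\<^sub>R B) *v incr g s (rescale \<phi> s))"
    unfolding lmap_def \<phi>_def[symmetric] Let_def integrand_eq by simp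
  also have "(LINT s:{..0}|lborel. mat_exp (- s *\<^sub>R B) *v incr g s (rescale \<phi> s)) = backward (\<lambda>s. incr g s (\<Phi> s)) 0"
    unfolding backward_def by (rule set_lebesgue_integral_cong) (auto simp: eq)
  finally show ?thesis .
qed

text \<open>The linear parts are additive, so the difference of two orbits of the transformed system
  is governed by \<open>field\<close>.\<close>

lemma field_eq: "field s P = transformed_field s (P + flow p0 s) - transformed_field s (flow p0 s)"
  by (simp add: field_def transformed_field_def incr_def matrix_vector_right_distrib)

lemma Wfiber_iff: "p \<in> Wfiber \<omega> A B f g \<eta> p0 \<longleftrightarrow> weighted_bounded {..0} weight (\<lambda>t. flow p t - flow p0 t)"
  unfolding Wfiber_def mem_Collect_eq Cminus_iff
  by (simp add: phi_eq_flow flip: scaleR_right_diff_distrib exp_add)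

text \<open>The difference of the two orbits solves the equation of \<open>field\<close> and is
  weighted bounded, hence is a Lyapunov-Perron solution. Its second component at time 0 is
  \<open>snd p - snd p0\<close> and also the backward integral.\<close>

lemma Wfiber_subset:
  assumes "p \<in> Wfiber \<omega> A B f g \<eta> p0"
  shows "snd p = lmap \<omega> A B f g \<eta> p0 (fst p)"
proof -
  obtain L where L: "tame D L transformed_field" using tame_transformed_field by blast
  let ?\<Phi> = "\<lambda>t. flow p t - flow p0 t"
  have "?\<Phi> t = (p - p0) + primitive (\<lambda>s. field s (?\<Phi> s)) t" for t
  proof -
    have "primitive (\<lambda>s. field s (?\<Phi> s)) t = primitive (\<lambda>r. transformed_field r (flow p r)) t - primitive (\<lambda>r. transformed_field r (flow p0 r)) t"
      unfolding field_eq by (simp add: primitive_diff tame_loc_integrable[OF L flow(1)])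
    thus ?thesis using flow(2)[of p t] flow(2)[of p0 t] by simp
  qed
  from flow_imp_lp_solution[OF _ assms[unfolded Wfiber_iff] this]
  have sol: "lp_solution (fst p - fst p0) ?\<Phi>" by (simp add: continuous_on_diff flow(1))
  hence "?\<Phi> 0 = lp_map (fst p - fst p0) ?\<Phi> 0" by (simp add: lp_solution_def)
  moreover have "?\<Phi> 0 = p - p0" using flow(2)[of p 0] flow(2)[of p0 0] by simp
  ultimately have eq: "p - p0 = lp_map (fst p - fst p0) ?\<Phi> 0" by metis
  have "snd p - snd p0 = snd (p - p0)" by simp
  also have "\<dots> = backward (\<lambda>s. incr g s (?\<Phi> s)) 0" unfolding eq by (simp add: lp_map_def)
  finally have "snd p - snd p0 = backward (\<lambda>s. incr g s (?\<Phi> s)) 0" .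
  thus ?thesis using lmap_eq[OF sol] by (simp add: algebra_simps)
qed

text \<open>Adding the orbit of \<open>p0\<close> to a Lyapunov-Perron path gives a path from
  \<open>p\<close> that solves the transformed equation for nonpositive times. Uniqueness identifies
  it with the orbit of \<open>p\<close>, so the difference of the orbits inherits the weighted
  bound.\<close>

lemma graph_subset_Wfiber: "(\<xi>, lmap \<omega> A B f g \<eta> p0 \<xi>) \<in> Wfiber \<omega> A B f g \<eta> p0"
proof -
  obtain L where L: "tame D L transformed_field" using tame_transformed_field by blast
  obtain \<Phi> where \<Phi>: "lp_solution (\<xi> - fst p0) \<Phi>" using lp_solution_exists by blast
  define p where "p = (\<xi>, lmap \<omega> A B f g \<eta> p0 \<xi>)"
  define P where "P = (\<lambda>t. \<Phi> (min t 0))"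
  have P: "continuous_on UNIV P"
    unfolding P_def by (rule lp_solution_imp_flow(1)[OF \<Phi>])
  have P_eq: "P t = (\<xi> - fst p0, backward (\<lambda>s. incr g s (\<Phi> s)) 0) + primitive (\<lambda>s. field s (P s)) t"
    if "t \<le> 0" for t
    unfolding P_def by (rule lp_solution_imp_flow(2)[OF \<Phi> that])
  have cont: "continuous_on UNIV (\<lambda>t. P t + flow p0 t)" by (intro continuous_on_add P flow(1))
  \<comment> \<open>Uniqueness is used on segments from 0 down to \<open>c\<close>, since for
    positive times \<open>P\<close> is merely an extension.\<close>
  have "flow p c = P c + flow p0 c" if "c \<le> 0" for c
  proof (rule flow_unique[OF L flow(1) cont flow(2)])
    fix t assume "t \<in> closed_segment 0 c"
    hence t: "t \<le> 0" using that by (auto simp: closed_segment_eq_real_ivl split: if_splits)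
    have "primitive (\<lambda>s. field s (P s)) t = primitive (\<lambda>r. transformed_field r (P r + flow p0 r)) t - primitive (\<lambda>r. transformed_field r (flow p0 r)) t"
      unfolding field_eq by (simp add: primitive_diff tame_loc_integrable[OF L flow(1)] tame_loc_integrable[OF L cont])
    thus "P t + flow p0 t = p + primitive (\<lambda>r. transformed_field r (P r + flow p0 r)) t"
      using P_eq[OF t] flow(2)[of p0 t] lmap_eq[OF \<Phi>] by (simp add: p_def prod_eq_iff)
  qed
  hence "flow p t - flow p0 t = \<Phi> t" if "t \<le> 0" for t using that by (simp add: P_def)
  moreover have "weighted_bounded {..0} weight \<Phi>" using \<Phi> by (simp add: lp_solution_def)
  ultimately have "weighted_bounded {..0} weight (\<lambda>t. flow p t - flow p0 t)"
    unfolding weighted_bounded_def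
    by (auto intro!: continuous_on_diff continuous_on_subset[OF flow(1)])
  thus ?thesis unfolding Wfiber_iff p_def .
qed

lemma Wfiber_eq_graph: "Wfiber \<omega> A B f g \<eta> p0 = {(\<xi>, lmap \<omega> A B f g \<eta> p0 \<xi>) | \<xi>. True}"
  using Wfiber_subset graph_subset_Wfiber by (auto simp: prod_eq_iff)

lemma lmap_lipschitz:
  "norm (lmap \<omega> A B f g \<eta> p0 \<xi>1 - lmap \<omega> A B f g \<eta> p0 \<xi>2)
    \<le> K / ((\<eta> - b) * (1 - K * (1 / (\<eta> - b) + 1 / (a - \<eta>)))) * norm (\<xi>1 - \<xi>2)"
proof -
  obtain \<Phi>1 \<Phi>2 where \<Phi>: "lp_solution (\<xi>1 - fst p0) \<Phi>1" "lp_solution (\<xi>2 - fst p0) \<Phi>2"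
    using lp_solution_exists by blast
  show ?thesis
    using lp_solution_backward_lipschitz[OF \<Phi>] by (simp add: lmap_eq[OF \<Phi>(1)] lmap_eq[OF \<Phi>(2)] rate_def)
qed

end

theorem theorem4p1:
  fixes \<Omega> :: "(real \<Rightarrow> real) set" and \<omega> :: "real \<Rightarrow> real"
    and A :: "real^'n^'n" and B :: "real^'m^'m"
    and f :: "real^'n \<Rightarrow> real^'m \<Rightarrow> real^'n" and g :: "real^'n \<Rightarrow> real^'m \<Rightarrow> real^'m"
    and a b K \<eta> :: real and p0 :: "(real^'n) \<times> (real^'m)"
  assumes Omega: "Omega_props \<Omega>"
    and A1A: "\<And>t x. t \<le> 0 \<Longrightarrow> norm (mat_exp (t *\<^sub>R A) *v x) \<le> exp (a * t) * norm x"
    and A1B: "\<And>t y. t \<ge> 0 \<Longrightarrow> norm (mat_exp (t *\<^sub>R B) *v y) \<le> exp (b * t) * norm y"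
    and ab: "b < 0" "0 < a"
    and f0: "f 0 0 = 0" and g0: "g 0 0 = 0"
    and f_lip: "\<And>x1 y1 x2 y2. norm (f x1 y1 - f x2 y2) \<le> K * (norm (x1 - x2) + norm (y1 - y2))"
    and g_lip: "\<And>x1 y1 x2 y2. norm (g x1 y1 - g x2 y2) \<le> K * (norm (x1 - x2) + norm (y1 - y2))"
    and eta: "\<eta> > 0" "b < \<eta>" "\<eta> < a"
    and gap: "K * (1 / (\<eta> - b) + 1 / (a - \<eta>)) < 1"
    and om: "\<omega> \<in> \<Omega>"
  shows "(\<forall>\<xi>. \<exists>\<phi>. LP_sol \<omega> A B f g \<eta> p0 (\<xi> - fst p0) \<phi> \<and>
              (\<forall>\<psi>. LP_sol \<omega> A B f g \<eta> p0 (\<xi> - fst p0) \<psi> \<longrightarrow> (\<forall>t\<le>0. \<psi> t = \<phi> t)) \<and>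
              set_integrable lborel {..0}
                (\<lambda>s. exp (Iz \<omega> s 0) *\<^sub>R (mat_exp ((- s) *\<^sub>R B) *v Delta \<omega> A B f g g p0 s (\<phi> s))))
       \<and> Wfiber \<omega> A B f g \<eta> p0 = {(\<xi>, lmap \<omega> A B f g \<eta> p0 \<xi>) | \<xi>. True}
       \<and> (\<forall>\<xi>1 \<xi>2. norm (lmap \<omega> A B f g \<eta> p0 \<xi>1 - lmap \<omega> A B f g \<eta> p0 \<xi>2)
              \<le> K / ((\<eta> - b) * (1 - K * (1 / (\<eta> - b) + 1 / (a - \<eta>)))) * norm (\<xi>1 - \<xi>2))"
proof -
  interpret rde_fiber \<omega> A B f g K a b \<eta> p0
    using Omega om A1A A1B f0 g0 f_lip g_lip eta gap
    by unfold_locales (auto simp: Omega_props_def)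
  show ?thesis
    using LP_sol_exists LP_sol_unique LP_sol_integrable Wfiber_eq_graph lmap_lipschitz by meson
qed

end
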